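(* Assume that $\mathcal{Q}\succeq 0$ and that the diagonal blocks $Q_{i,i}$ are symmetric positive definite for all $i=1,\ldots,s$. Then $$\widehat{\mathcal{Q}} := \mathcal{Q}+\mathcal{T}_{\mathcal{Q}} = (\mathcal{D}+\mathcal{U})\mathcal{D}^{-1}(\mathcal{D}+\mathcal{U}^* )\succ 0 .$$ Let $\bar{\mathbf{x}}=(\bar x_1;\ldots;\bar x_s)\in\mathcal{X}$ and let $\boldsymbol{\delta}',\boldsymbol{\delta}\in\mathcal{X}$ be two vectors with $\delta_1'=\delta_1$. For $i=s,s-1,\ldots,2$ (in this order) define $x_i'\in\mathcal{X}_i$ by $$x_i' := \operatorname*{argmin}_{x_i\in\mathcal{X}_i}\ \Big\{p(\bar x_1)+q(\bar x_{\le i-1};x_i;x'_{\ge i+1})-\langle \delta_i',x_i\rangle\Big\} = Q_{i,i}^{-1}\Big(b_i+\delta_i'-\sum_{j=1}^{i-1}Q_{j,i}^*\bar x_j-\sum_{j=i+1}^{s}Q_{i,j}x_j'\Big).$$ Then the optimal solution $$\mathbf{x}^+ := \operatorname*{argmin}_{\mathbf{x}\in\mathcal{X}}\ \Big\{p(x_1)+q(\mathbf{x})+\tfrac12\|\mathbf{x}-\bar{\mathbf{x}}\|_{\mathcal{T}_{\mathcal{Q}}}^2-\langle \mathbf{x},\Delta(\boldsymbol{\delta}',\boldsymbol{\delta})\rangle\Big\}$$ is computed exactly by the following steps: $$x_1^+ = \operatorname*{argmin}_{x_1\in\mathcal{X}_1}\ \Big\{p(x_1)+q(x_1;x'_{\ge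 2})-\langle\delta_1,x_1\rangle\Big\},$$ and, for $i=2,\ldots,s$ (in this order), $$x_i^+ = \operatorname*{argmin}_{x_i\in\mathcal{X}_i}\ \Big\{p(x_1^+)+q(x^+_{\le i-1};x_i;x'_{\ge i+1})-\langle\delta_i,x_i\rangle\Big\} = Q_{i,i}^{-1}\Big(b_i+\delta_i-\sum_{j=1}^{i-1}Q_{j,i}^*x_j^+-\sum_{j=i+1}^{s}Q_{i,j}x_j'\Big).$$ That is, $\mathbf{x}^+=(x_1^+;\ldots;x_s^+)$.
   Context: Let $s\ge 2$, $\mathcal{X}_i=\mathbb{R}^{n_i}$ for $i=1,\ldots,s$, and $\mathcal{X}=\mathcal{X}_1\times\cdots\times\mathcal{X}_s$; write $\mathbf{x}=(x_1;\ldots;x_s)\in\mathcal{X}$, with the standard inner product $\langle\cdot,\cdot\rangle$. Let $\mathcal{Q}$ be a symmetric block matrix on $\mathcal{X}$ whose $(i,j)$ block for $i\le j$ is $Q_{i,j}\in\mathbb{R}^{n_i\times n_j}$ and whose $(j,i)$ block for $i<j$ is $Q_{i,j}^*$ ($^*$ denotes transpose). Let $\mathcal{U}$ be the strictly block upper triangular part of $\mathcal{Q}$ and $\mathcal{D}=\mathrm{diag}(Q_{1,1},\ldots,Q_{s,s})$ its block diagonal part, so $\mathcal{Q}=\mathcal{U}+\mathcal{D}+\mathcal{U}^*$. The sGS linear operator is $\mathcal{T}_{\mathcal{Q}}=\mathcal{U}\mathcal{D}^{-1}\mathcal{U}^*$. Let $\mathbf{b}=(b_1;\ldots;b_s)\in\mathcal{X}$,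 $q(\mathbf{x})=\frac12\langle\mathbf{x},\mathcal{Q}\mathbf{x}\rangle-\langle\mathbf{b},\mathbf{x}\rangle$, and let $p:\mathcal{X}_1\to(-\infty,\infty]$ be a proper closed convex function. For a symmetric positive semidefinite matrix $\mathcal{T}$, $\|\mathbf{x}\|_{\mathcal{T}}^2=\langle\mathbf{x},\mathcal{T}\mathbf{x}\rangle$. For $\boldsymbol{\delta}',\boldsymbol{\delta}\in\mathcal{X}$, $\Delta(\boldsymbol{\delta}',\boldsymbol{\delta})=\boldsymbol{\delta}+\mathcal{U}\mathcal{D}^{-1}(\boldsymbol{\delta}-\boldsymbol{\delta}')$. Notation: $x_{\le i}=(x_1;\ldots;x_i)$, $x_{\ge i}=(x_i;\ldots;x_s)$, and $x_{\ge s+1}$ is empty. In the definition of $x_i'$, the term $p(\bar x_1)$ is constant in $x_i$ and is disregarded if $p(\bar x_1)=+\infty$ (i.e. $x_i'$ is given by the explicit formula). *)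

theory Defs
  imports
    "HOL-Library.Extended_Real"
    "Jordan_Normal_Form.Matrix"
    "Jordan_Normal_Form.Gauss_Jordan_Elimination"
begin

section \<open>Block vectors and block matrices\<close>

text \<open>
  The blocks are numbered \<open>1, \<dots>, s\<close> and block \<open>i\<close> has dimension \<open>n i\<close>. The product space
  \<open>\<real>\<^bsup>n 1\<^esup> \<times> \<dots> \<times> \<real>\<^bsup>n s\<^esup>\<close> is identified with \<open>carrier_vec (total_dim n s)\<close> by concatenation:
  block \<open>i\<close> occupies the coordinates \<open>offset n i, \<dots>, offset n (Suc i) - 1\<close>.
\<close>

definition offset :: "(nat \<Rightarrow> nat) \<Rightarrow> nat \<Rightarrow> nat" where
  "offset n i = (\<Sum>k\<in>{1..<i}. n k)"

definition total_dim :: "(nat \<Rightarrow> nat) \<Rightarrow> nat \<Rightarrow> nat" where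
  "total_dim n s = (\<Sum>k\<in>{1..s}. n k)"

text \<open>The number of the block that contains the flat coordinate \<open>r\<close>.\<close>

definition block_of :: "(nat \<Rightarrow> nat) \<Rightarrow> nat \<Rightarrow> nat" where
  "block_of n r = (LEAST i. r < offset n (Suc i))"

definition block :: "(nat \<Rightarrow> nat) \<Rightarrow> real vec \<Rightarrow> nat \<Rightarrow> real vec" where
  "block n x i = vec (n i) (\<lambda>a. x $ (offset n i + a))"

definition block_vec :: "(nat \<Rightarrow> nat) \<Rightarrow> nat \<Rightarrow> (nat \<Rightarrow> real vec) \<Rightarrow> real vec" where
  "block_vec n s f = vec (total_dim n s)
     (\<lambda>r. f (block_of n r) $ (r - offset n (block_of n r)))"

definition block_mat :: "(nat \<Rightarrow> nat) \<Rightarrow> nat \<Rightarrow> (nat \<Rightarrow> nat \<Rightarrow> real mat) \<Rightarrow> real mat" where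
  "block_mat n s B = mat (total_dim n s) (total_dim n s)
     (\<lambda>(r, c). B (block_of n r) (block_of n c) $$
        (r - offset n (block_of n r), c - offset n (block_of n c)))"

text \<open>The family \<open>(y\<^bsub><i\<^esub>; u; z\<^bsub>>i\<^esub>)\<close>.\<close>

definition block_splice :: "nat \<Rightarrow> (nat \<Rightarrow> 'a) \<Rightarrow> 'a \<Rightarrow> (nat \<Rightarrow> 'a) \<Rightarrow> nat \<Rightarrow> 'a" where
  "block_splice i y u z = (\<lambda>j. if j < i then y j else if j = i then u else z j)"


section \<open>Matrices, minimisers and convex functions\<close>

definition pos_semidef :: "real mat \<Rightarrow> bool" where
  "pos_semidef A \<longleftrightarrow> square_mat A \<and> A\<^sup>T = A \<and>
     (\<forall>x\<in>carrier_vec (dim_row A). 0 \<le> x \<bullet> (A *\<^sub>v x))"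

definition pos_def :: "real mat \<Rightarrow> bool" where
  "pos_def A \<longleftrightarrow> square_mat A \<and> A\<^sup>T = A \<and>
     (\<forall>x\<in>carrier_vec (dim_row A). x \<noteq> 0\<^sub>v (dim_row A) \<longrightarrow> 0 < x \<bullet> (A *\<^sub>v x))"

text \<open>Meaningful only for nonsingular matrices.\<close>

definition inv_mat :: "real mat \<Rightarrow> real mat" where
  "inv_mat A = the (mat_inverse A)"

definition sq_norm_wrt :: "real mat \<Rightarrow> real vec \<Rightarrow> real" where
  "sq_norm_wrt A x = x \<bullet> (A *\<^sub>v x)"

definition argmin_set :: "('a \<Rightarrow> ereal) \<Rightarrow> 'a set \<Rightarrow> 'a set" where
  "argmin_set f X = {x. is_arg_min f (\<lambda>x. x \<in> X) x}"

definition proper_fun :: "nat \<Rightarrow> (real vec \<Rightarrow> ereal) \<Rightarrow> bool" where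
  "proper_fun d p \<longleftrightarrow> (\<forall>x\<in>carrier_vec d. p x \<noteq> -\<infinity>) \<and> (\<exists>x\<in>carrier_vec d. p x \<noteq> \<infinity>)"

definition convex_fun :: "nat \<Rightarrow> (real vec \<Rightarrow> ereal) \<Rightarrow> bool" where
  "convex_fun d p \<longleftrightarrow> (\<forall>x\<in>carrier_vec d. \<forall>y\<in>carrier_vec d. \<forall>t. 0 < t \<and> t < 1 \<longrightarrow>
     p (t \<cdot>\<^sub>v x + (1 - t) \<cdot>\<^sub>v y) \<le> ereal t * p x + ereal (1 - t) * p y)"

text \<open>
  A function is closed if its epigraph is a closed subset of \<open>\<real>\<^bsup>d\<^esup> \<times> \<real>\<close>. The type of vectors carries
  no topology, so sequential closedness is used; convergence in \<open>\<real>\<^bsup>d\<^esup>\<close> is coordinatewise convergence.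
\<close>

definition closed_fun :: "nat \<Rightarrow> (real vec \<Rightarrow> ereal) \<Rightarrow> bool" where
  "closed_fun d p \<longleftrightarrow> (\<forall>(X :: nat \<Rightarrow> real vec) (R :: nat \<Rightarrow> real) x r.
     (\<forall>k. X k \<in> carrier_vec d \<and> p (X k) \<le> ereal (R k)) \<and> x \<in> carrier_vec d \<and>
     (\<forall>a<d. (\<lambda>k. X k $ a) \<longlonglongrightarrow> x $ a) \<and> R \<longlonglongrightarrow> r \<longrightarrow> p x \<le> ereal r)"


section \<open>Symmetric Gauss--Seidel decomposition\<close>

text \<open>
  Only the blocks \<open>Q i j\<close> with \<open>1 \<le> i \<le> j \<le> s\<close> are data; the others are determined by symmetry.
\<close>

definition sgs_mat :: "(nat \<Rightarrow> nat) \<Rightarrow> nat \<Rightarrow> (nat \<Rightarrow> nat \<Rightarrow> real mat) \<Rightarrow> real mat" where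
  "sgs_mat n s Q = block_mat n s (\<lambda>i j. if i \<le> j then Q i j else (Q j i)\<^sup>T)"

definition sgs_upper :: "(nat \<Rightarrow> nat) \<Rightarrow> nat \<Rightarrow> (nat \<Rightarrow> nat \<Rightarrow> real mat) \<Rightarrow> real mat" where
  "sgs_upper n s Q = block_mat n s (\<lambda>i j. if i < j then Q i j else 0\<^sub>m (n i) (n j))"

definition sgs_diag :: "(nat \<Rightarrow> nat) \<Rightarrow> nat \<Rightarrow> (nat \<Rightarrow> nat \<Rightarrow> real mat) \<Rightarrow> real mat" where
  "sgs_diag n s Q = block_mat n s (\<lambda>i j. if i = j then Q i j else 0\<^sub>m (n i) (n j))"

definition sgs_op :: "(nat \<Rightarrow> nat) \<Rightarrow> nat \<Rightarrow> (nat \<Rightarrow> nat \<Rightarrow> real mat) \<Rightarrow> real mat" where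
  "sgs_op n s Q = sgs_upper n s Q * inv_mat (sgs_diag n s Q) * (sgs_upper n s Q)\<^sup>T"

definition sgs_quad ::
  "(nat \<Rightarrow> nat) \<Rightarrow> nat \<Rightarrow> (nat \<Rightarrow> nat \<Rightarrow> real mat) \<Rightarrow> real vec \<Rightarrow> real vec \<Rightarrow> real" where
  "sgs_quad n s Q b x = 1 / 2 * (x \<bullet> (sgs_mat n s Q *\<^sub>v x)) - b \<bullet> x"

definition sgs_Delta ::
  "(nat \<Rightarrow> nat) \<Rightarrow> nat \<Rightarrow> (nat \<Rightarrow> nat \<Rightarrow> real mat) \<Rightarrow> real vec \<Rightarrow> real vec \<Rightarrow> real vec" where
  "sgs_Delta n s Q \<delta>' \<delta> =
     \<delta> + (sgs_upper n s Q * inv_mat (sgs_diag n s Q)) *\<^sub>v (\<delta> - \<delta>')"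

text \<open>
  \<open>Q\<^bsub>i,i\<^esub>\<close>-inverse applied to \<open>c - (\<Sum>j<i. Q\<^bsub>j,i\<^esub>-transpose y\<^bsub>j\<^esub>) - (\<Sum>j>i. Q\<^bsub>i,j\<^esub> z\<^bsub>j\<^esub>)\<close>.
\<close>

definition sgs_solve ::
  "(nat \<Rightarrow> nat) \<Rightarrow> nat \<Rightarrow> (nat \<Rightarrow> nat \<Rightarrow> real mat) \<Rightarrow> nat \<Rightarrow> real vec \<Rightarrow>
   (nat \<Rightarrow> real vec) \<Rightarrow> (nat \<Rightarrow> real vec) \<Rightarrow> real vec" where
  "sgs_solve n s Q i c y z = inv_mat (Q i i) *\<^sub>v
     (c - finsum_vec TYPE(real) (n i) (\<lambda>j. (Q j i)\<^sup>T *\<^sub>v y j) {1..i - 1}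
        - finsum_vec TYPE(real) (n i) (\<lambda>j. Q i j *\<^sub>v z j) {i + 1..s})"

end

theory Submission
  imports Defs "Jordan_Normal_Form.Determinant"
begin

text \<open>
  The objective is a complete square: \<open>Q + T = (D + U) D\<inverse> (D + U\<^sup>T)\<close>, and the definition of the blocks \<open>x'\<close>
  turns its linear term into \<open>(D + U) D\<inverse> c\<close> for \<open>c = b + \<delta> - U x'\<close>. Up to a constant the
  objective is therefore \<open>p (x 1)\<close> plus half the squared \<open>D\<inverse>\<close>-norm of \<open>(D + U\<^sup>T) x - c\<close>. The latter splits
  into one square per block: the first involves only \<open>x 1\<close>, and the later ones are annihilated in turn by
  the forward sweep. So only the strongly convex problem in \<open>x 1\<close> needs an existence argument.
\<close>

section \<open>Positive definite matrices\<close>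

text \<open>In blocks 2 to \<open>s\<close> the definition of \<open>x'\<close> reads
  \<open>D x' = b + \<delta>' - U\<^sup>T xbar - U x'\<close>, that is,
  \<open>c - D x' = U\<^sup>T xbar + (\<delta> - \<delta>')\<close>. Applying
  \<open>U D\<inverse>\<close>, which does not see block 1, shows that the proximal term and the
  correction in \<open>sgs_Delta\<close> together contribute \<open>U D\<inverse> c - U x'\<close>.
  Added to \<open>b + \<delta>\<close> this gives
  \<open>c + U D\<inverse> c = (D + U) D\<inverse> c\<close>; the shape of \<open>sgs_Delta\<close>
  is chosen for this cancellation. Block \<open>i\<close> of
  \<open>D\<inverse> ((D + U\<^sup>T) x - c)\<close> is the residual of the forward solve,
  \<open>x i\<close> minus the value computed from the earlier blocks of \<open>x\<close> and the
  later blocks of \<open>x'\<close>. The inverse of \<open>D\<close> is never written out by blocks: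
  block identities are compared after multiplication by \<open>D\<close>, and \<open>Q i i\<close>
  is cancelled. Minimisers are stated as singleton argmin sets. Every minimisation argument
  therefore has to produce a strict inequality against all competitors, including those at which
  \<open>p\<close> is infinite.\<close>

lemma pos_def_inverse:
  assumes A: "A \<in> carrier_mat d d" and pd: "pos_def A"
  shows inv_mat_carrier: "inv_mat A \<in> carrier_mat d d"
    and mult_inv_mat: "A * inv_mat A = 1\<^sub>m d"
    and inv_mat_mult: "inv_mat A * A = 1\<^sub>m d"
proof -
  have "det A \<noteq> 0"
  proof
    assume "det A = 0"
    then obtain v where v: "v \<in> carrier_vec d" "v \<noteq> 0\<^sub>v d" "A *\<^sub>v v = 0\<^sub>v d"
      using det_0_iff_vec_prod_zero_field[OF A] by auto
    then have "0 < v \<bullet> (A *\<^sub>v v)" using pd A unfolding pos_def_def by auto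
    with v show False by simp
  qed
  \<comment> \<open>\<open>inv_mat\<close> selects the value of an option, so invertibility has to
    rule out \<open>None\<close>.\<close>
  from det_non_zero_imp_unit[OF A this, of "()"] mat_inverse(1)[OF A, of "()"]
  obtain B where "mat_inverse A = Some B" by (cases "mat_inverse A") auto
  with mat_inverse(2)[OF A this]
  show "inv_mat A \<in> carrier_mat d d" "A * inv_mat A = 1\<^sub>m d" "inv_mat A * A = 1\<^sub>m d"
    by (auto simp: inv_mat_def)
qed

lemma pos_def_transpose: "pos_def A \<Longrightarrow> A\<^sup>T = A"
  by (simp add: pos_def_def)

lemma pos_def_pos:
  assumes "pos_def A" "A \<in> carrier_mat d d" "x \<in> carrier_vec d" "x \<noteq> 0\<^sub>v d"
  shows "0 < x \<bullet> (A *\<^sub>v x)"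
  using assms by (auto simp: pos_def_def)

lemma pos_def_nonneg:
  assumes "pos_def A" "A \<in> carrier_mat d d" "x \<in> carrier_vec d"
  shows "0 \<le> x \<bullet> (A *\<^sub>v x)"
  using pos_def_pos[OF assms] assms by (cases "x = 0\<^sub>v d") auto

text \<open>Replaces a block formula for the inverse of \<open>D\<close>: two candidates for a block
  are identified once their products with \<open>Q i i\<close> agree.\<close>

lemma pos_def_mult_cancel:
  assumes "pos_def A" "A \<in> carrier_mat d d" "x \<in> carrier_vec d" "y \<in> carrier_vec d"
    and eq: "A *\<^sub>v x = A *\<^sub>v y"
  shows "x = y"
proof -
  have "inv_mat A *\<^sub>v (A *\<^sub>v z) = z" if "z \<in> carrier_vec d" for z
    using that inv_mat_mult[OF assms(2,1)] inv_mat_carrier[OF assms(2,1)] assms(2)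
    by (metis assoc_mult_mat_vec one_mult_mat_vec)
  with assms show ?thesis by metis
qed

lemma mult_inv_mat_vec:
  assumes "pos_def A" "A \<in> carrier_mat d d" "x \<in> carrier_vec d"
  shows "A *\<^sub>v (inv_mat A *\<^sub>v x) = x"
  using assms mult_inv_mat[OF assms(2,1)] inv_mat_carrier[OF assms(2,1)]
  by (metis assoc_mult_mat_vec one_mult_mat_vec)

lemma inv_mat_mult_vec:
  assumes "pos_def A" "A \<in> carrier_mat d d" "x \<in> carrier_vec d"
  shows "inv_mat A *\<^sub>v (A *\<^sub>v x) = x"
  using assms inv_mat_mult[OF assms(2,1)] inv_mat_carrier[OF assms(2,1)]
  by (metis assoc_mult_mat_vec one_mult_mat_vec)

lemma bilinear_transpose:
  fixes A :: "'a :: comm_ring_1 mat"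
  assumes "A \<in> carrier_mat d e" "x \<in> carrier_vec d" "y \<in> carrier_vec e"
  shows "x \<bullet> (A *\<^sub>v y) = y \<bullet> (A\<^sup>T *\<^sub>v x)"
proof -
  have "(A\<^sup>T *\<^sub>v x) \<bullet> y = x \<bullet> (A *\<^sub>v y)"
    by (rule transpose_vec_mult_scalar[OF assms(1,3,2)])
  then show ?thesis
    using assms by (metis comm_scalar_prod mult_mat_vec_carrier transpose_carrier_mat)
qed

text \<open>The scalar \<open>t\<close> stays explicit because the expansion is used along rays
  going to infinity, at a midpoint, and with \<open>t = 1\<close> for a change of one block.\<close>

lemma quad_form_add:
  fixes A :: "real mat"
  assumes A: "A \<in> carrier_mat d d" "A\<^sup>T = A" and x: "x \<in> carrier_vec d" and y: "y \<in> carrier_vec d"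
  shows "(x + t \<cdot>\<^sub>v y) \<bullet> (A *\<^sub>v (x + t \<cdot>\<^sub>v y)) =
    x \<bullet> (A *\<^sub>v x) + 2 * t * (y \<bullet> (A *\<^sub>v x)) + t\<^sup>2 * (y \<bullet> (A *\<^sub>v y))"
proof -
  have [simp]: "A *\<^sub>v x \<in> carrier_vec d" "A *\<^sub>v y \<in> carrier_vec d" using A x y by auto
  have e: "A *\<^sub>v (x + t \<cdot>\<^sub>v y) = A *\<^sub>v x + t \<cdot>\<^sub>v (A *\<^sub>v y)"
    using A x y by (simp add: mult_add_distrib_mat_vec mult_mat_vec)
  have "x \<bullet> (A *\<^sub>v y) = y \<bullet> (A *\<^sub>v x)" using bilinear_transpose[OF A(1) x y] A(2) by simp
  then show ?thesis using x y
    by (simp add: e add_scalar_prod_distrib[of _ d] scalar_prod_add_distrib[of _ d] power2_eq_square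
        algebra_simps)
qed

lemma quad_form_sum:
  fixes A :: "real mat"
  assumes "A \<in> carrier_mat d d" "x \<in> carrier_vec d" "y \<in> carrier_vec d"
  shows "x \<bullet> (A *\<^sub>v y) = (\<Sum>i<d. \<Sum>j<d. x $ i * A $$ (i, j) * y $ j)"
  using assms by (auto simp: scalar_prod_def atLeast0LessThan sum_distrib_left ac_simps intro!: sum.cong)

section \<open>Existence of proximal points\<close>

text \<open>Each new coordinate is handled by a monotone, hence convergent, subsequence, and the
  earlier coordinates keep their limits along it. Stating it for families of reals lets the
  induction add a coordinate without changing the objects.\<close>

lemma bounded_convergent_subseq:
  fixes X :: "nat \<Rightarrow> nat \<Rightarrow> real"
  assumes "\<And>k a. a < d \<Longrightarrow> \<bar>X k a\<bar> \<le> M"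
  shows "\<exists>r l. strict_mono r \<and> (\<forall>a<d. (\<lambda>k. X (r k) a) \<longlonglongrightarrow> l a)"
  using assms
proof (induction d)
  case 0
  show ?case by (rule exI[of _ id]) (auto simp: strict_mono_def)
next
  case (Suc d)
  then obtain r l where r: "strict_mono r" "\<And>a. a < d \<Longrightarrow> (\<lambda>k. X (r k) a) \<longlonglongrightarrow> l a"
    by (metis less_SucI)
  obtain f where f: "strict_mono f" "monoseq (\<lambda>k. X (r (f k)) d)"
    using seq_monosub[of "\<lambda>k. X (r k) d"] by auto
  have "Bseq (\<lambda>k. X (r (f k)) d)"
    by (rule BseqI'[of _ M]) (use Suc.prems in auto)
  then obtain c where c: "(\<lambda>k. X (r (f k)) d) \<longlonglongrightarrow> c"
    using Bseq_monoseq_convergent f(2) unfolding convergent_def by blast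
  have "(\<lambda>k. X ((r \<circ> f) k) a) \<longlonglongrightarrow> (l(d := c)) a" if "a < Suc d" for a
  proof (cases "a = d")
    case False
    then show ?thesis using LIMSEQ_subseq_LIMSEQ[OF r(2)[of a] f(1)] that by (simp add: o_def)
  qed (use c in simp)
  then show ?case using strict_mono_o[OF r(1) f(1)] by blast
qed

lemma bounded_vec_convergent_subseq:
  fixes X :: "nat \<Rightarrow> real vec"
  assumes "\<And>k a. a < d \<Longrightarrow> \<bar>X k $ a\<bar> \<le> M"
  obtains r x where "strict_mono r" "x \<in> carrier_vec d"
    "\<And>a. a < d \<Longrightarrow> (\<lambda>k. X (r k) $ a) \<longlonglongrightarrow> x $ a"
proof -
  obtain r l where "strict_mono r" "\<And>a. a < d \<Longrightarrow> (\<lambda>k. X (r k) $ a) \<longlonglongrightarrow> l a"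
    using bounded_convergent_subseq[of d "\<lambda>k a. X k $ a" M] assms by blast
  then show ?thesis by (intro that[of r "vec d l"]) auto
qed

text \<open>\<open>closed_fun\<close> demands its bound at every index; dropping an initial segment
  makes an eventual bound sufficient.\<close>

lemma closed_fun_limit:
  assumes p: "closed_fun d p" and X: "\<And>k. X k \<in> carrier_vec d" "x \<in> carrier_vec d"
    "\<And>a. a < d \<Longrightarrow> (\<lambda>k. X k $ a) \<longlonglongrightarrow> x $ a"
    and R: "R \<longlonglongrightarrow> r" and le: "eventually (\<lambda>k. p (X k) \<le> ereal (R k)) sequentially"
  shows "p x \<le> ereal r"
proof -
  obtain N where N: "\<And>k. N \<le> k \<Longrightarrow> p (X k) \<le> ereal (R k)"
    using le by (auto simp: eventually_sequentially)
  have "(\<lambda>k. X (k + N) $ a) \<longlonglongrightarrow> x $ a" if "a < d" for a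
    using X(3)[OF that] by (rule LIMSEQ_ignore_initial_segment)
  moreover have "(\<lambda>k. R (k + N)) \<longlonglongrightarrow> r"
    using R by (rule LIMSEQ_ignore_initial_segment)
  ultimately show ?thesis
    using p[unfolded closed_fun_def, rule_format, of "\<lambda>k. X (k + N)" "\<lambda>k. R (k + N)" x r] X N
    by auto
qed

text \<open>Any real \<open>r\<close> eventually bounds the values from above, so closedness puts
  the limit value below every \<open>r\<close>. This is how divergence to minus infinity is brought
  into conflict with properness.\<close>

lemma closed_fun_limit_unbounded:
  assumes "closed_fun d p" "\<And>k. X k \<in> carrier_vec d" "x \<in> carrier_vec d"
    "\<And>a. a < d \<Longrightarrow> (\<lambda>k. X k $ a) \<longlonglongrightarrow> x $ a"
    and le: "\<And>k. p (X k) \<le> ereal (R k)" and R: "filterlim R at_bot sequentially"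
  shows "p x = -\<infinity>"
proof -
  have "p x \<le> ereal r" for r
  proof (rule closed_fun_limit[OF assms(1-4) tendsto_const])
    have "eventually (\<lambda>k. R k \<le> r) sequentially" using R by (auto simp: filterlim_at_bot)
    then show "eventually (\<lambda>k. p (X k) \<le> ereal r) sequentially"
      by (rule eventually_mono) (rule order_trans[OF le], simp)
  qed
  then show ?thesis by (metis ereal_bot)
qed

text \<open>In coordinates the form is a finite sum of products, so coordinatewise convergence is
  enough.\<close>

lemma tendsto_quad_form:
  fixes A :: "real mat"
  assumes "A \<in> carrier_mat d d" "\<And>k. X k \<in> carrier_vec d" "x \<in> carrier_vec d"
    "\<And>a. a < d \<Longrightarrow> (\<lambda>k. X k $ a) \<longlonglongrightarrow> x $ a"
    "\<And>k. Y k \<in> carrier_vec d" "y \<in> carrier_vec d"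
    "\<And>a. a < d \<Longrightarrow> (\<lambda>k. Y k $ a) \<longlonglongrightarrow> y $ a"
  shows "(\<lambda>k. X k \<bullet> (A *\<^sub>v Y k)) \<longlonglongrightarrow> x \<bullet> (A *\<^sub>v y)"
proof -
  have "(\<lambda>k. \<Sum>i<d. \<Sum>j<d. X k $ i * A $$ (i, j) * Y k $ j)
      \<longlonglongrightarrow> (\<Sum>i<d. \<Sum>j<d. x $ i * A $$ (i, j) * y $ j)"
    by (intro tendsto_sum tendsto_mult tendsto_const assms(4,7)) auto
  then show ?thesis using assms by (simp add: quad_form_sum)
qed

text \<open>The direct method: a minimising sequence in a bounded sublevel set has a convergent
  subsequence, and closedness transfers the bound to its limit. The same compactness argument shows
  beforehand that the infimum is finite.\<close>

lemma closed_fun_attains_min: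
  assumes f: "closed_fun d f" and ninf: "\<And>x. x \<in> carrier_vec d \<Longrightarrow> f x \<noteq> -\<infinity>"
    and u0: "u0 \<in> carrier_vec d" "f u0 \<noteq> \<infinity>"
    and bnd: "\<And>x a. x \<in> carrier_vec d \<Longrightarrow> f x \<le> f u0 \<Longrightarrow> a < d \<Longrightarrow> \<bar>x $ a\<bar> \<le> M"
  shows "\<exists>u\<in>carrier_vec d. f u \<noteq> \<infinity> \<and> (\<forall>v\<in>carrier_vec d. f u \<le> f v)"
proof -
  define L where "L = {x \<in> carrier_vec d. f x \<le> f u0}"
  \<comment> \<open>On \<open>L\<close> the values of \<open>f\<close> are finite, so infima can be
    taken in the reals.\<close>
  define F where "F x = real_of_ereal (f x)" for x
  have fF: "f x = ereal (F x)" if "x \<in> L" for x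
    using that ninf[of x] u0 unfolding L_def F_def by (cases "f x") auto
  have u0L: "u0 \<in> L" using u0 by (simp add: L_def)
  have bndL: "\<bar>x $ a\<bar> \<le> M" if "x \<in> L" "a < d" for x a
    using bnd that by (simp add: L_def)
  have bdd: "bdd_below (F ` L)"
  proof (rule ccontr)
    assume nb: "\<not> bdd_below (F ` L)"
    have "\<exists>x\<in>L. F x < - real k" for k
      using nb by (auto simp: bdd_below_def not_le)
    then obtain X where X: "\<And>k. X k \<in> L" "\<And>k. F (X k) < - real k" by metis
    obtain r x where r: "strict_mono r" and x: "x \<in> carrier_vec d"
      "\<And>a. a < d \<Longrightarrow> (\<lambda>k. X (r k) $ a) \<longlonglongrightarrow> x $ a"
      using bounded_vec_convergent_subseq[of d X M] bndL[OF X(1)] by blast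
    have "f x = -\<infinity>"
    proof (rule closed_fun_limit_unbounded[OF f _ x])
      show "X (r k) \<in> carrier_vec d" for k using X(1) by (simp add: L_def)
      show "f (X (r k)) \<le> ereal (- real k)" for k
        \<comment> \<open>A strictly increasing \<open>r\<close> satisfies
          \<open>k \<le> r k\<close>, so the bound \<open>- r k\<close> is at most
          \<open>- k\<close>.\<close>
        using X(2)[of "r k"] fF[OF X(1)] seq_suble[OF r, of k] by simp
      show "filterlim (\<lambda>k. - real k) at_bot sequentially"
        by (rule iffD1[OF filterlim_uminus_at_top filterlim_real_sequentially])
    qed
    with ninf[OF x(1)] show False ..
  qed
  define I where "I = Inf (F ` L)"
  have "\<exists>x\<in>L. F x < I + inverse (real (Suc k))" for k
    using cInf_lessD[of "F ` L" "I + inverse (real (Suc k))"] u0L unfolding I_def by auto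
  then obtain X where X: "\<And>k. X k \<in> L" "\<And>k. F (X k) < I + inverse (real (Suc k))" by metis
  obtain r x where r: "strict_mono r" and x: "x \<in> carrier_vec d"
    "\<And>a. a < d \<Longrightarrow> (\<lambda>k. X (r k) $ a) \<longlonglongrightarrow> x $ a"
    using bounded_vec_convergent_subseq[of d X M] bndL[OF X(1)] by blast
  have lim: "(\<lambda>k. I + inverse (real (Suc k))) \<longlonglongrightarrow> I"
    using LIMSEQ_inverse_real_of_nat_add by blast
  have fx: "f x \<le> ereal I"
  proof (rule closed_fun_limit[OF f _ x])
    show "X (r k) \<in> carrier_vec d" for k using X(1) by (simp add: L_def)
    show "(\<lambda>k. I + inverse (real (Suc (r k)))) \<longlonglongrightarrow> I"
      using LIMSEQ_subseq_LIMSEQ[OF lim r] by (simp add: o_def)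
    show "eventually (\<lambda>k. f (X (r k)) \<le> ereal (I + inverse (real (Suc (r k))))) sequentially"
      using X(2) fF[OF X(1)] by (auto intro!: always_eventually less_imp_le)
  qed
  have IL: "ereal I \<le> f v" if "v \<in> L" for v
    using cInf_lower[OF _ bdd, of "F v"] that fF[OF that] unfolding I_def by auto
  have "f x \<le> f v" if v: "v \<in> carrier_vec d" for v
  proof (cases "f v \<le> f u0")
    case True
    then show ?thesis using IL[of v] fx v unfolding L_def by auto
  next
    case False
    \<comment> \<open>Outside the sublevel set \<open>f v\<close> exceeds \<open>f u0\<close>, which
      is already at least \<open>I\<close>.\<close>
    then show ?thesis using IL[OF u0L] fx by (meson nle_le order_trans)
  qed
  moreover have "f x \<noteq> \<infinity>" using fx by auto
  ultimately show ?thesis using x(1) by blast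
qed

text \<open>The quadratic is finite and continuous, so it can be moved to the other side of the
  epigraph inequality, where the bounds still form a convergent real sequence.\<close>

lemma closed_fun_add_quad:
  assumes p: "closed_fun d p" and A: "A \<in> carrier_mat d d" and a: "a \<in> carrier_vec d"
  shows "closed_fun d (\<lambda>u. p u + ereal (c * ((u - a) \<bullet> (A *\<^sub>v (u - a)))))"
  unfolding closed_fun_def
proof (intro allI impI; elim conjE)
  fix X :: "nat \<Rightarrow> real vec" and R x r
  define g where "g u = c * ((u - a) \<bullet> (A *\<^sub>v (u - a)))" for u
  assume X: "\<forall>k. X k \<in> carrier_vec d \<and>
      p (X k) + ereal (c * ((X k - a) \<bullet> (A *\<^sub>v (X k - a)))) \<le> ereal (R k)"
    and x: "x \<in> carrier_vec d" and lim: "\<forall>a<d. (\<lambda>k. X k $ a) \<longlonglongrightarrow> x $ a" and R: "R \<longlonglongrightarrow> r"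
  have g: "(\<lambda>k. g (X k)) \<longlonglongrightarrow> g x"
    unfolding g_def using X x lim a
    by (intro tendsto_mult tendsto_const tendsto_quad_form[OF A]) (auto intro!: tendsto_intros)
  have "p (X k) \<le> ereal (R k - g (X k))" for k
    using X[rule_format, of k] by (cases "p (X k)") (auto simp: g_def)
  then have "p x \<le> ereal (r - g x)"
    using closed_fun_limit[OF p _ x _ tendsto_diff[OF R g], of X] X lim by auto
  then have "p x + ereal (g x) \<le> ereal r" by (cases "p x") auto
  then show "p x + ereal (c * ((x - a) \<bullet> (A *\<^sub>v (x - a)))) \<le> ereal r" by (simp add: g_def)
qed

section \<open>Boundedness of sublevel sets, existence and uniqueness in the strongly convex
  problem\<close>

text \<open>Were the sublevel set unbounded, with \<open>v\<close> a limiting direction, then \<open>p (u0 + v) = -\<infinity>\<close>: by convexity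
  \<open>p\<close> near \<open>u0 + v\<close> lies below chords to far-away points, where \<open>p\<close> is dominated by minus a quadratic.\<close>

lemma prox_sublevel_bounded:
  assumes proper: "proper_fun d p" and clo: "closed_fun d p" and cvx: "convex_fun d p"
    and A: "A \<in> carrier_mat d d" and pd: "pos_def A" and a: "a \<in> carrier_vec d"
    and u0: "u0 \<in> carrier_vec d" "p u0 \<noteq> \<infinity>"
  defines "f \<equiv> (\<lambda>u. p u + ereal (1 / 2 * ((u - a) \<bullet> (A *\<^sub>v (u - a)))))"
  shows "\<exists>M. \<forall>x\<in>carrier_vec d. f x \<le> f u0 \<longrightarrow> (\<forall>a<d. \<bar>x $ a\<bar> \<le> M)"
proof -
  note symA = pos_def_transpose[OF pd]
  \<comment> \<open>The sum norm dominates each coordinate and passes to coordinatewise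
    limits.\<close>
  define nrm :: "real vec \<Rightarrow> real" where "nrm x = (\<Sum>i<d. \<bar>x $ i\<bar>)" for x
  have comp_le: "\<bar>x $ i\<bar> \<le> nrm x" if "i < d" for x i
    unfolding nrm_def using that by (intro member_le_sum) auto
  have ninf: "p x \<noteq> -\<infinity>" if "x \<in> carrier_vec d" for x
    using proper that by (simp add: proper_fun_def)
  obtain c0 where c0: "p u0 = ereal c0" using u0 ninf[of u0] by (cases "p u0") auto
  define g where "g u = 1 / 2 * ((u - a) \<bullet> (A *\<^sub>v (u - a)))" for u
  have fg: "f u = p u + ereal (g u)" for u by (simp add: f_def g_def)
  have "\<exists>M. \<forall>x\<in>carrier_vec d. f x \<le> f u0 \<longrightarrow> nrm (x - u0) \<le> M"
  proof (rule ccontr)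
    assume "\<not> ?thesis"
    \<comment> \<open>The summand 1 makes \<open>t k > 1\<close>, so that \<open>1 / t k\<close> is
      an admissible weight in \<open>convex_fun\<close>.\<close>
    then have "\<exists>x\<in>carrier_vec d. f x \<le> f u0 \<and> nrm (x - u0) > real k + 1" for k :: nat
      by (meson not_less)
    then obtain X where X: "\<And>k. X k \<in> carrier_vec d" "\<And>k. f (X k) \<le> f u0"
      "\<And>k. nrm (X k - u0) > real k + 1" by metis
    define t where "t k = nrm (X k - u0)" for k
    define D where "D k = (1 / t k) \<cdot>\<^sub>v (X k - u0)" for k
    have t1: "t k > real k + 1" for k using X(3) by (simp add: t_def)
    have t1': "t k > 1" "t k \<noteq> 0" for k using t1[of k] by linarith+
    have D: "D k \<in> carrier_vec d" for k using X u0 by (auto simp: D_def)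
    have XD: "X k = u0 + t k \<cdot>\<^sub>v D k" for k
      using X(1)[of k] u0 t1'[of k] unfolding D_def by (intro eq_vecI) auto
    have nD: "nrm (D k) = 1" for k
    proof -
      have "nrm (D k) = (\<Sum>i<d. (1 / t k) * \<bar>(X k - u0) $ i\<bar>)"
        unfolding nrm_def D_def using X(1)[of k] u0 t1'[of k]
        by (intro sum.cong) (auto simp: abs_mult)
      also have "\<dots> = 1" using t1'[of k] by (simp only: sum_distrib_left[symmetric]) (simp add: t_def nrm_def)
      finally show ?thesis .
    qed
    have "\<bar>D k $ i\<bar> \<le> 1" if "i < d" for k i using comp_le[OF that, of "D k"] nD by simp
    then obtain r v where r: "strict_mono r" and v: "v \<in> carrier_vec d"
      "\<And>i. i < d \<Longrightarrow> (\<lambda>k. D (r k) $ i) \<longlonglongrightarrow> v $ i"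
      using bounded_vec_convergent_subseq[of d D 1] by blast
    \<comment> \<open>Norm one survives the limit; hence \<open>v\<close> is nonzero and the
      curvature of the quadratic along \<open>v\<close> is positive.\<close>
    have "(\<lambda>k. nrm (D (r k))) \<longlonglongrightarrow> nrm v"
      unfolding nrm_def using v by (intro tendsto_sum tendsto_rabs) auto
    then have "nrm v = 1" using nD by (simp add: LIMSEQ_const_iff)
    then have "v \<noteq> 0\<^sub>v d" by (auto simp: nrm_def)
    then have pos: "v \<bullet> (A *\<^sub>v v) > 0" using pos_def_pos[OF pd A v(1)] by simp
    define bb where "bb k = D k \<bullet> (A *\<^sub>v (u0 - a))" for k
    define cc where "cc k = D k \<bullet> (A *\<^sub>v D k)" for k
    have bb: "(\<lambda>k. bb (r k)) \<longlonglongrightarrow> v \<bullet> (A *\<^sub>v (u0 - a))"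
      unfolding bb_def using D v u0 a by (intro tendsto_quad_form[OF A]) auto
    have cc: "(\<lambda>k. cc (r k)) \<longlonglongrightarrow> v \<bullet> (A *\<^sub>v v)"
      unfolding cc_def using D v u0 a by (intro tendsto_quad_form[OF A]) auto
    have gX: "g (X k) = g u0 + t k * bb k + 1 / 2 * (t k)\<^sup>2 * cc k" for k
    proof -
      have "X k - a = (u0 - a) + t k \<cdot>\<^sub>v D k"
        using D[of k] u0 a unfolding XD by (intro eq_vecI) auto
      then show ?thesis
        using quad_form_add[OF A symA _ D[of k], of "u0 - a" "t k"] u0 a
        by (simp add: g_def bb_def cc_def algebra_simps)
    qed
    \<comment> \<open>The sublevel condition gives \<open>p (X k) \<le> c0 + g u0 - g (X k)\<close>.
      Weighting it by \<open>1 / t k\<close> lowers the powers of \<open>t k\<close> by one: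
      \<open>bb k\<close> converges along \<open>r\<close>, while \<open>t k * cc k\<close> still
      diverges.\<close>
    define R where "R k = c0 - bb k - 1 / 2 * t k * cc k" for k
    have le: "p (u0 + D k) \<le> ereal (R k)" for k
    proof -
      obtain ck where ck: "p (X k) = ereal ck" "ck \<le> c0 + g u0 - g (X k)"
        using X(2)[of k] ninf[OF X(1)[of k]] by (cases "p (X k)") (auto simp: fg c0)
      \<comment> \<open>The unit step from \<open>u0\<close> towards \<open>X k\<close> lies on the
        chord to \<open>X k\<close>, at parameter \<open>1 / t k\<close>.\<close>
      have "u0 + D k = (1 / t k) \<cdot>\<^sub>v X k + (1 - 1 / t k) \<cdot>\<^sub>v u0"
        using X(1)[of k] u0 t1'[of k] unfolding D_def by (intro eq_vecI) (auto simp: field_simps)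
      then have "p (u0 + D k) \<le> ereal (1 / t k) * p (X k) + ereal (1 - 1 / t k) * p u0"
        using cvx[unfolded convex_fun_def, rule_format, OF X(1)[of k] u0(1), of "1 / t k"] t1'[of k]
        by simp
      also have "\<dots> = ereal (1 / t k * ck + (1 - 1 / t k) * c0)" by (simp add: ck(1) c0)
      also have "1 / t k * ck + (1 - 1 / t k) * c0 \<le> R k"
      proof -
        have "ck \<le> c0 - t k * bb k - 1 / 2 * (t k)\<^sup>2 * cc k" using ck(2) gX[of k] by simp
        then have "1 / t k * ck \<le> 1 / t k * (c0 - t k * bb k - 1 / 2 * (t k)\<^sup>2 * cc k)"
          using t1'[of k] by (intro mult_left_mono) auto
        also have "\<dots> = R k - (1 - 1 / t k) * c0"
          using t1'[of k] by (simp add: R_def field_simps power2_eq_square)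
        finally show ?thesis by simp
      qed
      finally show ?thesis by simp
    qed
    have "filterlim (\<lambda>k. t (r k)) at_top sequentially"
    proof (rule filterlim_at_top_mono[OF filterlim_real_sequentially])
      have "real k \<le> t (r k)" for k
        using t1[of "r k"] seq_suble[OF r, of k] by linarith
      then show "eventually (\<lambda>k. real k \<le> t (r k)) sequentially" by simp
    qed
    from filterlim_tendsto_pos_mult_at_top[OF cc pos this]
    have "filterlim (\<lambda>k. 1 / 2 * (cc (r k) * t (r k))) at_top sequentially"
      by (intro filterlim_tendsto_pos_mult_at_top[OF tendsto_const]) auto
    from filterlim_tendsto_add_at_top[OF bb this]
    have "filterlim (\<lambda>k. (- c0) + (bb (r k) + 1 / 2 * (cc (r k) * t (r k)))) at_top sequentially"
      by (rule filterlim_tendsto_add_at_top[OF tendsto_const])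
    then have "filterlim (\<lambda>k. - ((- c0) + (bb (r k) + 1 / 2 * (cc (r k) * t (r k))))) at_bot sequentially"
      by (rule iffD1[OF filterlim_uminus_at_top])
    moreover have "(\<lambda>k. - ((- c0) + (bb (r k) + 1 / 2 * (cc (r k) * t (r k))))) = (\<lambda>k. R (r k))"
      by (auto simp: R_def)
    ultimately have "filterlim (\<lambda>k. R (r k)) at_bot sequentially" by simp
    have "p (u0 + v) = -\<infinity>"
    proof (rule closed_fun_limit_unbounded[OF clo])
      show "(\<lambda>k. (u0 + D (r k)) $ i) \<longlonglongrightarrow> (u0 + v) $ i" if "i < d" for i
        using tendsto_add[OF tendsto_const[of "u0 $ i"] v(2)[OF that]] that u0 v(1)
        by (simp add: carrier_vecD[OF D])
    qed (use u0 D v le \<open>filterlim (\<lambda>k. R (r k)) at_bot sequentially\<close> in auto)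
    then show False using ninf[of "u0 + v"] u0 v by auto
  qed
  then obtain M where M: "\<And>x. x \<in> carrier_vec d \<Longrightarrow> f x \<le> f u0 \<Longrightarrow> nrm (x - u0) \<le> M" by blast
  have "\<bar>x $ i\<bar> \<le> M + nrm u0" if "x \<in> carrier_vec d" "f x \<le> f u0" "i < d" for x i
    using M[OF that(1,2)] comp_le[OF that(3), of "x - u0"] comp_le[OF that(3), of u0] that u0
    by simp
  then show ?thesis by blast
qed

text \<open>Existence comes from closedness and bounded sublevel sets. For strictness, a second
  minimiser \<open>v\<close> would make the midpoint better by one eighth of the form of
  \<open>A\<close> at \<open>v - u\<close>.\<close>

lemma prox_exists:
  assumes proper: "proper_fun d p" and clo: "closed_fun d p" and cvx: "convex_fun d p"
    and A: "A \<in> carrier_mat d d" and pd: "pos_def A" and a: "a \<in> carrier_vec d"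
  shows "\<exists>u\<in>carrier_vec d. p u \<noteq> \<infinity> \<and> (\<forall>v\<in>carrier_vec d. v \<noteq> u \<longrightarrow>
    p u + ereal (1 / 2 * ((u - a) \<bullet> (A *\<^sub>v (u - a)))) <
    p v + ereal (1 / 2 * ((v - a) \<bullet> (A *\<^sub>v (v - a)))))"
proof -
  note symA = pos_def_transpose[OF pd]
  define g where "g u = 1 / 2 * ((u - a) \<bullet> (A *\<^sub>v (u - a)))" for u
  have ninf: "p x \<noteq> -\<infinity>" if "x \<in> carrier_vec d" for x
    using proper that by (simp add: proper_fun_def)
  obtain u0 where u0: "u0 \<in> carrier_vec d" "p u0 \<noteq> \<infinity>"
    using proper by (auto simp: proper_fun_def)
  obtain M where M: "\<And>x i. x \<in> carrier_vec d \<Longrightarrow> p x + ereal (g x) \<le> p u0 + ereal (g u0) \<Longrightarrow> i < d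
      \<Longrightarrow> \<bar>x $ i\<bar> \<le> M"
    using prox_sublevel_bounded[OF assms u0] unfolding g_def by blast
  have "closed_fun d (\<lambda>u. p u + ereal (g u))"
    unfolding g_def by (rule closed_fun_add_quad[OF clo A a])
  from closed_fun_attains_min[OF this _ u0(1) _ M] ninf u0(2)
  obtain u where u: "u \<in> carrier_vec d" "p u \<noteq> \<infinity>"
    and min: "\<And>v. v \<in> carrier_vec d \<Longrightarrow> p u + ereal (g u) \<le> p v + ereal (g v)" by auto
  have "p u + ereal (g u) < p v + ereal (g v)" if v: "v \<in> carrier_vec d" "v \<noteq> u" for v
  proof (rule ccontr)
    assume "\<not> ?thesis"
    then have eq: "p u + ereal (g u) = p v + ereal (g v)" using min[OF v(1)] by simp
    obtain cu where cu: "p u = ereal cu" using u ninf[of u] by (cases "p u") auto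
    obtain cv where cv: "p v = ereal cv" using eq cu ninf[OF v(1)] by (cases "p v") auto
    have eqr: "cu + g u = cv + g v" using eq by (simp add: cu cv)
    \<comment> \<open>The midpoint; \<open>1 - 1 / 2\<close> is left as it is to match
      \<open>convex_fun\<close> at \<open>t = 1 / 2\<close>.\<close>
    define z where "z = (1 / 2) \<cdot>\<^sub>v u + (1 - 1 / 2) \<cdot>\<^sub>v v"
    define w where "w = v - u"
    have w: "w \<in> carrier_vec d" using u v by (auto simp: w_def)
    have "w \<noteq> 0\<^sub>v d"
    proof
      assume w0: "w = 0\<^sub>v d"
      have "v = u + w" using u v by (intro eq_vecI) (auto simp: w_def)
      then show False using w0 u v by simp
    qed
    then have pos: "w \<bullet> (A *\<^sub>v w) > 0" using pos_def_pos[OF pd A w] by simp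
    have gw: "g y = g u + t * (w \<bullet> (A *\<^sub>v (u - a))) + 1 / 2 * t\<^sup>2 * (w \<bullet> (A *\<^sub>v w))"
      if "y = u + t \<cdot>\<^sub>v w" for y t
    proof -
      have "y - a = (u - a) + t \<cdot>\<^sub>v w"
        using that w u a by (intro eq_vecI) auto
      then show ?thesis
        using quad_form_add[OF A symA _ w, of "u - a" t] u a
        by (simp add: g_def algebra_simps)
    qed
    have gv: "g v = g u + 1 * (w \<bullet> (A *\<^sub>v (u - a))) + 1 / 2 * 1\<^sup>2 * (w \<bullet> (A *\<^sub>v w))"
      by (rule gw) (use u v in \<open>auto simp: w_def intro!: eq_vecI\<close>)
    have gz: "g z = g u + (1 / 2) * (w \<bullet> (A *\<^sub>v (u - a))) + 1 / 2 * (1 / 2)\<^sup>2 * (w \<bullet> (A *\<^sub>v w))"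
      by (rule gw) (use u v in \<open>auto simp: z_def w_def field_simps intro!: eq_vecI\<close>)
    have z: "z \<in> carrier_vec d" using u v by (auto simp: z_def)
    have "p z \<le> ereal (1 / 2) * p u + ereal (1 - 1 / 2) * p v"
      using cvx[unfolded convex_fun_def, rule_format, OF u(1) v(1), of "1 / 2"]
      unfolding z_def by simp
    also have "\<dots> = ereal (1 / 2 * cu + (1 - 1 / 2) * cv)" by (simp add: cu cv)
    finally have pz: "p z \<le> ereal (1 / 2 * cu + (1 - 1 / 2) * cv)" .
    then obtain cz where cz: "p z = ereal cz" using ninf[OF z] by (cases "p z") auto
    \<comment> \<open>The average of \<open>g u\<close> and \<open>g v\<close> has curvature
      coefficient 1/4, the midpoint only 1/8, and the linear parts cancel; convexity of
      \<open>p\<close> preserves the gap.\<close>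
    show False
      using pz min[OF z] eqr gv gz pos by (simp add: cz cu power2_eq_square)
  qed
  then show ?thesis using u unfolding g_def by blast
qed

section \<open>Block coordinates\<close>

lemma offset_Suc: "1 \<le> i \<Longrightarrow> offset n (Suc i) = offset n i + n i"
  by (simp add: offset_def)

lemma total_dim_Suc: "total_dim n (Suc s) = total_dim n s + n (Suc s)"
  by (simp add: total_dim_def)

lemma offset_Suc_total_dim: "offset n (Suc s) = total_dim n s"
  by (simp add: offset_def total_dim_def atLeastLessThanSuc_atLeastAtMost)

lemma offset_mono: "i \<le> j \<Longrightarrow> offset n i \<le> offset n j"
  unfolding offset_def by (rule sum_mono2) auto

text \<open>The least index is correct even next to blocks of dimension 0: for \<open>j < i\<close>,
  monotonicity puts the end of block \<open>j\<close> at or before the start of block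
  \<open>i\<close>.\<close>

lemma block_of_offset:
  assumes "1 \<le> i" "a < n i"
  shows "block_of n (offset n i + a) = i"
  unfolding block_of_def
proof (rule Least_equality)
  show "offset n i + a < offset n (Suc i)" using assms by (simp add: offset_Suc)
  fix j assume j: "offset n i + a < offset n (Suc j)"
  show "i \<le> j"
  proof (rule ccontr)
    assume "\<not> i \<le> j"
    then have "offset n (Suc j) \<le> offset n i" by (intro offset_mono) simp
    with j show False by simp
  qed
qed

lemma offset_add_less:
  assumes "1 \<le> i" "i \<le> s" "a < n i"
  shows "offset n i + a < total_dim n s"
proof -
  have "offset n (Suc i) \<le> offset n (Suc s)" using assms by (intro offset_mono) simp
  then show ?thesis
    unfolding offset_Suc[OF assms(1)] offset_Suc_total_dim[of n s] using assms(3) by simp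
qed

lemma block_coordinate:
  assumes "r < total_dim n s"
  obtains i a where "1 \<le> i" "i \<le> s" "a < n i" "r = offset n i + a"
proof -
  have "\<exists>i a. 1 \<le> i \<and> i \<le> s \<and> a < n i \<and> r = offset n i + a"
    using assms
  proof (induction s)
    case (Suc s)
    show ?case
    proof (cases "r < total_dim n s")
      case True
      with Suc show ?thesis by (meson le_SucI)
    next
      case False
      with Suc.prems show ?thesis
        by (intro exI[of _ "Suc s"] exI[of _ "r - total_dim n s"])
          (auto simp: offset_Suc_total_dim total_dim_Suc)
    qed
  qed (simp add: total_dim_def)
  then show ?thesis using that by blast
qed

lemma sum_lessThan_add:
  fixes f :: "nat \<Rightarrow> 'a :: comm_monoid_add"
  shows "sum f {..<m + k} = sum f {..<m} + (\<Sum>a<k. f (m + a))"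
  by (induction k) (auto simp: add.assoc)

lemma sum_block_coordinates:
  fixes f :: "nat \<Rightarrow> 'a :: comm_monoid_add"
  shows "sum f {..<total_dim n s} = (\<Sum>i = 1..s. \<Sum>a<n i. f (offset n i + a))"
  by (induction s)
    (simp_all add: total_dim_Suc sum_lessThan_add offset_Suc_total_dim, simp add: total_dim_def)

lemma block_carrier[simp]: "block n x i \<in> carrier_vec (n i)"
  by (simp add: block_def)

lemma dim_block[simp]: "dim_vec (block n x i) = n i"
  by (simp add: block_def)

lemma index_block[simp]: "a < n i \<Longrightarrow> block n x i $ a = x $ (offset n i + a)"
  by (simp add: block_def)

lemma block_vec_carrier[simp]: "block_vec n s f \<in> carrier_vec (total_dim n s)"
  by (simp add: block_vec_def)

lemma block_block_vec:
  assumes "1 \<le> i" "i \<le> s" "f i \<in> carrier_vec (n i)"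
  shows "block n (block_vec n s f) i = f i"
  using assms by (intro eq_vecI) (auto simp: block_vec_def block_of_offset offset_add_less)

lemma block_eqI:
  assumes "x \<in> carrier_vec (total_dim n s)" "y \<in> carrier_vec (total_dim n s)"
    and eq: "\<And>i. 1 \<le> i \<Longrightarrow> i \<le> s \<Longrightarrow> block n x i = block n y i"
  shows "x = y"
proof (rule eq_vecI)
  fix r assume "r < dim_vec y"
  then obtain i a where i: "1 \<le> i" "i \<le> s" "a < n i" "r = offset n i + a"
    using assms block_coordinate by (metis carrier_vecD)
  then show "x $ r = y $ r" using eq[OF i(1,2)] index_block by metis
qed (use assms in simp)

lemma block_add:
  assumes "1 \<le> i" "i \<le> s" "x \<in> carrier_vec (total_dim n s)" "y \<in> carrier_vec (total_dim n s)"
  shows "block n (x + y) i = block n x i + block n y i"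
  using assms offset_add_less[OF assms(1,2)] by (intro eq_vecI) auto

lemma block_minus:
  assumes "1 \<le> i" "i \<le> s" "x \<in> carrier_vec (total_dim n s)" "y \<in> carrier_vec (total_dim n s)"
  shows "block n (x - y) i = block n x i - block n y i"
  using assms offset_add_less[OF assms(1,2)] by (intro eq_vecI) auto

lemma scalar_prod_blocks:
  assumes "x \<in> carrier_vec (total_dim n s)" "y \<in> carrier_vec (total_dim n s)"
  shows "x \<bullet> y = (\<Sum>i = 1..s. block n x i \<bullet> block n y i)"
proof -
  have "x \<bullet> y = (\<Sum>r<total_dim n s. x $ r * y $ r)"
    using assms by (simp add: scalar_prod_def atLeast0LessThan)
  then show ?thesis
    by (simp add: sum_block_coordinates) (simp add: scalar_prod_def atLeast0LessThan)
qed

text \<open>Checked coordinatewise, where it is the corresponding fact on real sums. It removes the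
  zero blocks from a row of a triangular or diagonal block matrix.\<close>

lemma finsum_vec_mono_neutral_cong:
  assumes "finite T" "S \<subseteq> T" and f: "f \<in> T \<rightarrow> carrier_vec d"
    and "\<And>j. j \<in> T - S \<Longrightarrow> f j = 0\<^sub>v d" and eq: "\<And>j. j \<in> S \<Longrightarrow> f j = g j"
  shows "finsum_vec TYPE(real) d f T = finsum_vec TYPE(real) d g S"
proof -
  have S: "finite S" using assms finite_subset by blast
  have g: "g \<in> S \<rightarrow> carrier_vec d" using f eq assms(2) by (metis (no_types, lifting) Pi_iff subsetD)
  show ?thesis
  proof (rule eq_vecI)
    fix a assume "a < dim_vec (finsum_vec TYPE(real) d g S)"
    then have a: "a < d" using finsum_vec_closed[OF g] by simp
    have "(\<Sum>j\<in>T. f j $ a) = (\<Sum>j\<in>S. g j $ a)"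
      using assms a by (intro sum.mono_neutral_cong_right) auto
    then show "finsum_vec TYPE(real) d f T $ a = finsum_vec TYPE(real) d g S $ a"
      using index_finsum_vec[OF assms(1) a f] index_finsum_vec[OF S a g] by simp
  qed (use finsum_vec_closed[OF g] finsum_vec_closed[OF f] in simp)
qed

section \<open>Block matrices acting on block vectors\<close>

lemma block_mat_carrier[simp]: "block_mat n s B \<in> carrier_mat (total_dim n s) (total_dim n s)"
  by (simp add: block_mat_def)

lemma dim_block_mat[simp]:
  "dim_row (block_mat n s B) = total_dim n s" "dim_col (block_mat n s B) = total_dim n s"
  by (simp_all add: block_mat_def)

lemma index_block_mat:
  assumes "1 \<le> i" "i \<le> s" "a < n i" "1 \<le> j" "j \<le> s" "c < n j"
  shows "block_mat n s B $$ (offset n i + a, offset n j + c) = B i j $$ (a, c)"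
  using assms by (simp add: block_mat_def block_of_offset offset_add_less)

text \<open>A flat row sum is regrouped block by block; only the blocks of row \<open>i\<close>
  enter.\<close>

lemma block_mat_mult_vec:
  assumes B: "\<And>j. 1 \<le> j \<Longrightarrow> j \<le> s \<Longrightarrow> B i j \<in> carrier_mat (n i) (n j)"
    and i: "1 \<le> i" "i \<le> s" and x: "x \<in> carrier_vec (total_dim n s)"
  shows "block n (block_mat n s B *\<^sub>v x) i =
    finsum_vec TYPE(real) (n i) (\<lambda>j. B i j *\<^sub>v block n x j) {1..s}"
proof -
  have car: "(\<lambda>j. B i j *\<^sub>v block n x j) \<in> {1..s} \<rightarrow> carrier_vec (n i)"
    by (rule Pi_I, rule mult_mat_vec_carrier[OF B]) auto
  show ?thesis
  proof (rule eq_vecI)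
    fix a assume "a < dim_vec (finsum_vec TYPE(real) (n i) (\<lambda>j. B i j *\<^sub>v block n x j) {1..s})"
    then have a: "a < n i" using finsum_vec_closed[OF car] by simp
    note lt = offset_add_less[of _ s _ n]
    have "block n (block_mat n s B *\<^sub>v x) i $ a =
        (\<Sum>r<total_dim n s. block_mat n s B $$ (offset n i + a, r) * x $ r)"
      using a x lt[OF i a] carrier_matD[OF block_mat_carrier[of n s B]]
      by (simp add: scalar_prod_def atLeast0LessThan)
    also have "\<dots> = (\<Sum>j = 1..s. \<Sum>c<n j. B i j $$ (a, c) * block n x j $ c)"
      using i a by (simp add: sum_block_coordinates index_block_mat)
    also have "\<dots> = (\<Sum>j = 1..s. (B i j *\<^sub>v block n x j) $ a)"
    proof (rule sum.cong)
      fix j assume "j \<in> {1..s}"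
      then have "B i j \<in> carrier_mat (n i) (n j)" using B by simp
      then show "(\<Sum>c<n j. B i j $$ (a, c) * block n x j $ c) = (B i j *\<^sub>v block n x j) $ a"
        using a by (simp add: scalar_prod_def atLeast0LessThan)
    qed simp
    also have "\<dots> = finsum_vec TYPE(real) (n i) (\<lambda>j. B i j *\<^sub>v block n x j) {1..s} $ a"
      by (rule index_finsum_vec[symmetric, OF _ a car]) simp
    finally show "block n (block_mat n s B *\<^sub>v x) i $ a = \<dots>" .
  qed (use finsum_vec_closed[OF car] in simp)
qed

lemma block_mat_eqI:
  assumes "A \<in> carrier_mat (total_dim n s) (total_dim n s)"
    "B \<in> carrier_mat (total_dim n s) (total_dim n s)"
    and eq: "\<And>i a j c. 1 \<le> i \<Longrightarrow> i \<le> s \<Longrightarrow> a < n i \<Longrightarrow> 1 \<le> j \<Longrightarrow> j \<le> s \<Longrightarrow> c < n j \<Longrightarrow>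
      A $$ (offset n i + a, offset n j + c) = B $$ (offset n i + a, offset n j + c)"
  shows "A = B"
proof (rule eq_matI)
  fix r q assume "r < dim_row B" "q < dim_col B"
  then have "r < total_dim n s" "q < total_dim n s" using assms(2) by auto
  then show "A $$ (r, q) = B $$ (r, q)" using eq by (metis block_coordinate)
qed (use assms in auto)

lemma block_mat_transpose:
  assumes "\<And>i j. 1 \<le> i \<Longrightarrow> i \<le> s \<Longrightarrow> 1 \<le> j \<Longrightarrow> j \<le> s \<Longrightarrow> B i j \<in> carrier_mat (n i) (n j)"
  shows "(block_mat n s B)\<^sup>T = block_mat n s (\<lambda>i j. (B j i)\<^sup>T)"
proof (rule block_mat_eqI[of _ n s])
  fix i a j c assume *: "1 \<le> i" "i \<le> s" "a < n i" "1 \<le> j" "j \<le> s" "c < n j"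
  then show "(block_mat n s B)\<^sup>T $$ (offset n i + a, offset n j + c) =
      block_mat n s (\<lambda>i j. (B j i)\<^sup>T) $$ (offset n i + a, offset n j + c)"
    using assms[of j i] offset_add_less[of i s a n] offset_add_less[of j s c n]
      carrier_matD[OF block_mat_carrier[of n s B]]
    by (simp add: index_block_mat)
qed simp_all

section \<open>The sGS operator\<close>

lemma finsum_vec_cong:
  assumes "f \<in> S \<rightarrow> carrier_vec d" "\<And>j. j \<in> S \<Longrightarrow> f j = g j" "finite S"
  shows "finsum_vec TYPE(real) d f S = finsum_vec TYPE(real) d g S"
  using assms by (intro finsum_vec_mono_neutral_cong) auto

lemma mult_block_carrier:
  "A \<in> carrier_mat (n i) (n j) \<Longrightarrow> A *\<^sub>v block n x j \<in> carrier_vec (n i)"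
  by (rule mult_mat_vec_carrier) auto

locale sgs_blocks =
  fixes s :: nat and n :: "nat \<Rightarrow> nat" and Q :: "nat \<Rightarrow> nat \<Rightarrow> real mat"
  assumes Q_carrier: "\<And>i j. 1 \<le> i \<Longrightarrow> i \<le> j \<Longrightarrow> j \<le> s \<Longrightarrow> Q i j \<in> carrier_mat (n i) (n j)"
    and Q_pos: "\<And>i. 1 \<le> i \<Longrightarrow> i \<le> s \<Longrightarrow> pos_def (Q i i)"
begin

abbreviation "N \<equiv> total_dim n s"
abbreviation "U \<equiv> sgs_upper n s Q"
abbreviation "D \<equiv> sgs_diag n s Q"
abbreviation "E \<equiv> inv_mat D"

lemma U_carrier[simp]: "U \<in> carrier_mat N N"
  by (simp add: sgs_upper_def)

lemma D_carrier[simp]: "D \<in> carrier_mat N N"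
  by (simp add: sgs_diag_def)

lemma sgs_mat_carrier[simp]: "sgs_mat n s Q \<in> carrier_mat N N"
  by (simp add: sgs_mat_def)

lemma Ut_carrier[simp]: "U\<^sup>T \<in> carrier_mat N N"
  by simp

lemma U_transpose:
  "U\<^sup>T = block_mat n s (\<lambda>i j. if j < i then (Q j i)\<^sup>T else 0\<^sub>m (n i) (n j))"
proof -
  have "U\<^sup>T = block_mat n s (\<lambda>i j. (if j < i then Q j i else 0\<^sub>m (n j) (n i))\<^sup>T)"
    unfolding sgs_upper_def by (rule block_mat_transpose) (use Q_carrier in auto)
  then show ?thesis by (simp add: if_distrib[of transpose_mat] cong: if_cong)
qed

lemma sgs_mat_decomp: "sgs_mat n s Q = U + D + U\<^sup>T"
proof (rule block_mat_eqI)
  fix i a j c assume *: "1 \<le> i" "i \<le> s" "a < n i" "1 \<le> j" "j \<le> s" "c < n j"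
  have lt: "offset n i + a < N" "offset n j + c < N" using * offset_add_less by auto
  show "sgs_mat n s Q $$ (offset n i + a, offset n j + c) =
      (U + D + U\<^sup>T) $$ (offset n i + a, offset n j + c)"
    using * lt carrier_matD[OF U_carrier] carrier_matD[OF D_carrier]
    unfolding sgs_mat_def U_transpose unfolding sgs_upper_def sgs_diag_def
    by (auto simp: index_block_mat)
qed simp_all

text \<open>After the zero blocks are dropped, the index range is exactly the one in
  \<open>sgs_solve\<close>; together with \<open>block_Ut\<close> this translates the sweeps into
  matrix algebra.\<close>

lemma block_U:
  assumes "1 \<le> i" "i \<le> s" "x \<in> carrier_vec N"
  shows "block n (U *\<^sub>v x) i = finsum_vec TYPE(real) (n i) (\<lambda>j. Q i j *\<^sub>v block n x j) {i + 1..s}"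
  unfolding sgs_upper_def
  by (subst block_mat_mult_vec)
    (use assms Q_carrier in \<open>auto intro!: finsum_vec_mono_neutral_cong mult_block_carrier\<close>)

lemma block_Ut:
  assumes "1 \<le> i" "i \<le> s" "x \<in> carrier_vec N"
  shows "block n (U\<^sup>T *\<^sub>v x) i =
    finsum_vec TYPE(real) (n i) (\<lambda>j. (Q j i)\<^sup>T *\<^sub>v block n x j) {1..i - 1}"
  unfolding U_transpose
  by (subst block_mat_mult_vec)
    (use assms Q_carrier in \<open>auto intro!: finsum_vec_mono_neutral_cong mult_block_carrier\<close>)

lemma block_D:
  assumes i: "1 \<le> i" "i \<le> s" and x: "x \<in> carrier_vec N"
  shows "block n (D *\<^sub>v x) i = Q i i *\<^sub>v block n x i"
proof -
  have Qi: "Q i i *\<^sub>v block n x i \<in> carrier_vec (n i)"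
    using Q_carrier[of i i] i by (auto intro!: mult_block_carrier)
  have "block n (D *\<^sub>v x) i = finsum_vec TYPE(real) (n i) (\<lambda>j. Q i j *\<^sub>v block n x j) {i}"
    unfolding sgs_diag_def
    by (subst block_mat_mult_vec)
      (use i x Qi Q_carrier in \<open>auto intro!: finsum_vec_mono_neutral_cong mult_block_carrier\<close>)
  also have "\<dots> = Q i i *\<^sub>v block n x i"
    using Qi by (subst finsum_vec_insert) (auto simp: finsum_vec_empty)
  finally show ?thesis .
qed

lemma D_quad:
  assumes "x \<in> carrier_vec N"
  shows "x \<bullet> (D *\<^sub>v x) = (\<Sum>i = 1..s. block n x i \<bullet> (Q i i *\<^sub>v block n x i))"
  using assms by (subst scalar_prod_blocks) (auto simp: block_D intro!: mult_mat_vec_carrier)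

text \<open>The form splits into the forms of the \<open>Q i i\<close>; a nonzero vector has a
  nonzero block, whose term is positive while the others are nonnegative.\<close>

lemma D_pos: "pos_def D"
proof -
  have sym: "D\<^sup>T = D"
  proof (rule block_mat_eqI)
    fix i a j c assume *: "1 \<le> i" "i \<le> s" "a < n i" "1 \<le> j" "j \<le> s" "c < n j"
    have lt: "offset n i + a < N" "offset n j + c < N" using * offset_add_less by auto
    \<comment> \<open>Symmetry has content only inside a diagonal block; elsewhere both entries are
      zero.\<close>
    have "Q i i $$ (c, a) = Q i i $$ (a, c)" if "i = j"
      using pos_def_transpose[OF Q_pos[of i]] Q_carrier[of i i] * that
      by (metis carrier_matD index_transpose_mat(1) order_refl)
    then show "D\<^sup>T $$ (offset n i + a, offset n j + c) = D $$ (offset n i + a, offset n j + c)"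
      using * lt carrier_matD[OF D_carrier]
      unfolding sgs_diag_def by (auto simp: index_block_mat)
  qed simp_all
  have "0 < x \<bullet> (D *\<^sub>v x)" if x: "x \<in> carrier_vec N" and nz: "x \<noteq> 0\<^sub>v N" for x
  proof -
    have "\<exists>i. 1 \<le> i \<and> i \<le> s \<and> block n x i \<noteq> 0\<^sub>v (n i)"
    proof (rule ccontr)
      assume "\<not> ?thesis"
      moreover have "block n (0\<^sub>v N) i = 0\<^sub>v (n i)" if "1 \<le> i" "i \<le> s" for i
        using offset_add_less[OF that] by (intro eq_vecI) auto
      ultimately have "x = 0\<^sub>v N" using x by (intro block_eqI[of x n s]) auto
      with nz show False ..
    qed
    then obtain i where i: "1 \<le> i" "i \<le> s" "block n x i \<noteq> 0\<^sub>v (n i)" by blast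
    show ?thesis
      unfolding D_quad[OF x]
    proof (rule sum_pos2[of _ i])
      show "0 < block n x i \<bullet> (Q i i *\<^sub>v block n x i)"
        using pos_def_pos[OF Q_pos[of i] Q_carrier[of i i]] i by simp
      show "0 \<le> block n x j \<bullet> (Q j j *\<^sub>v block n x j)" if "j \<in> {1..s}" for j
        using pos_def_nonneg[OF Q_pos[of j] Q_carrier[of j j]] that by simp
    qed (use i in auto)
  qed
  then show ?thesis using sym carrier_matD[OF D_carrier] by (auto simp: pos_def_def square_mat.simps)
qed

lemma E_carrier[simp]: "E \<in> carrier_mat N N"
  by (rule inv_mat_carrier[OF D_carrier D_pos])

lemma DE_vec[simp]: "x \<in> carrier_vec N \<Longrightarrow> D *\<^sub>v (E *\<^sub>v x) = x"
  by (rule mult_inv_mat_vec[OF D_pos D_carrier])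

lemma ED_vec[simp]: "x \<in> carrier_vec N \<Longrightarrow> E *\<^sub>v (D *\<^sub>v x) = x"
  by (rule inv_mat_mult_vec[OF D_pos D_carrier])

lemma mult_vec_carrier[simp]:
  "A \<in> carrier_mat N N \<Longrightarrow> x \<in> carrier_vec N \<Longrightarrow> A *\<^sub>v x \<in> carrier_vec N"
  by (rule mult_mat_vec_carrier)

text \<open>Transposing \<open>D * E = 1\<close> makes \<open>E\<^sup>T\<close> a left inverse of
  \<open>D\<close>, and a left inverse equals the right inverse \<open>E\<close>.\<close>

lemma E_transpose: "E\<^sup>T = E"
proof -
  have "E\<^sup>T * D = 1\<^sub>m N"
    using arg_cong[OF mult_inv_mat[OF D_carrier D_pos], of transpose_mat]
      transpose_mult[OF D_carrier E_carrier] pos_def_transpose[OF D_pos] by simp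
  then have "E = (E\<^sup>T * D) * E" by (simp add: left_mult_one_mat[OF E_carrier])
  also have "\<dots> = E\<^sup>T * (D * E)" by (rule assoc_mult_mat[of _ N N _ N _ N]) auto
  also have "\<dots> = E\<^sup>T" by (simp add: mult_inv_mat[OF D_carrier D_pos] right_mult_one_mat[of _ N N])
  finally show ?thesis by simp
qed

lemma sgs_op_carrier[simp]: "sgs_op n s Q \<in> carrier_mat N N"
  unfolding sgs_op_def by (intro mult_carrier_mat[of _ N N]) auto

lemma sgs_op_vec: "x \<in> carrier_vec N \<Longrightarrow> sgs_op n s Q *\<^sub>v x = U *\<^sub>v (E *\<^sub>v (U\<^sup>T *\<^sub>v x))"
  unfolding sgs_op_def
  by (simp add: assoc_mult_mat_vec[of _ N N _ N] mult_carrier_mat[of _ N N])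

lemma sgs_op_quad:
  assumes "x \<in> carrier_vec N"
  shows "x \<bullet> (sgs_op n s Q *\<^sub>v x) = (U\<^sup>T *\<^sub>v x) \<bullet> (E *\<^sub>v (U\<^sup>T *\<^sub>v x))"
  using assms bilinear_transpose[OF U_carrier assms, of "E *\<^sub>v (U\<^sup>T *\<^sub>v x)"]
  by (simp add: sgs_op_vec comm_scalar_prod[of _ N])

text \<open>Since \<open>y = D (E y)\<close>, the form of \<open>E\<close> at \<open>y\<close> is
  the form of \<open>D\<close> at \<open>E y\<close>.\<close>

lemma E_quad:
  assumes y: "y \<in> carrier_vec N"
  shows E_quad_nonneg: "0 \<le> y \<bullet> (E *\<^sub>v y)"
    and E_quad_pos: "y \<noteq> 0\<^sub>v N \<Longrightarrow> 0 < y \<bullet> (E *\<^sub>v y)"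
proof -
  have eq: "y \<bullet> (E *\<^sub>v y) = (E *\<^sub>v y) \<bullet> (D *\<^sub>v (E *\<^sub>v y))"
    using y by (simp add: comm_scalar_prod[of _ N])
  show "0 \<le> y \<bullet> (E *\<^sub>v y)" unfolding eq using y by (intro pos_def_nonneg[OF D_pos D_carrier]) simp
  assume nz: "y \<noteq> 0\<^sub>v N"
  have "E *\<^sub>v y \<noteq> 0\<^sub>v N"
  proof
    assume "E *\<^sub>v y = 0\<^sub>v N"
    then have "y = D *\<^sub>v 0\<^sub>v N" using DE_vec[OF y] by simp
    also have "\<dots> = 0\<^sub>v N"
      using carrier_matD[OF D_carrier] by (intro eq_vecI) (auto simp: scalar_prod_def)
    finally show False using nz by simp
  qed
  then show "0 < y \<bullet> (E *\<^sub>v y)" unfolding eq using y by (intro pos_def_pos[OF D_pos D_carrier]) simp_all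
qed

lemma sgs_mat_transpose: "(sgs_mat n s Q)\<^sup>T = sgs_mat n s Q"
proof -
  have "(U + D + U\<^sup>T)\<^sup>T = U\<^sup>T + D + U"
    using pos_def_transpose[OF D_pos] transpose_add[OF U_carrier D_carrier]
      transpose_add[of "U + D" N N "U\<^sup>T"] by simp
  also have "\<dots> = U + D + U\<^sup>T"
    using carrier_matD[OF U_carrier] carrier_matD[OF D_carrier] by (intro eq_matI) auto
  finally show ?thesis by (simp add: sgs_mat_decomp)
qed

lemma sgs_op_transpose: "(sgs_op n s Q)\<^sup>T = sgs_op n s Q"
proof -
  have "(sgs_op n s Q)\<^sup>T = U\<^sup>T\<^sup>T * (U * E)\<^sup>T"
    unfolding sgs_op_def by (rule transpose_mult[of _ N N _ N]) (auto intro!: mult_carrier_mat[of _ N N])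
  also have "(U * E)\<^sup>T = E * U\<^sup>T" by (subst transpose_mult[of _ N N _ N]) (auto simp: E_transpose)
  also have "U\<^sup>T\<^sup>T * (E * U\<^sup>T) = sgs_op n s Q"
    unfolding sgs_op_def by (simp add: assoc_mult_mat[of _ N N _ N _ N])
  finally show ?thesis .
qed

section \<open>Factorisation and positivity of \<open>Q + T\<close>\<close>

text \<open>\<open>(D + U) E = 1 + U E\<close>; multiplying by \<open>D + U\<^sup>T\<close> produces
  the three parts of \<open>Q\<close> and the extra term \<open>U E U\<^sup>T\<close>, which is the
  sGS operator.\<close>

lemma sgs_hat_factor: "sgs_mat n s Q + sgs_op n s Q = (D + U) * E * (D + U\<^sup>T)"
proof -
  have UE: "U * E \<in> carrier_mat N N" by (rule mult_carrier_mat[of _ N N]) auto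
  have "(D + U) * E = 1\<^sub>m N + U * E"
    by (subst add_mult_distrib_mat[of _ N N _ _ N]) (auto simp: mult_inv_mat[OF D_carrier D_pos])
  then have "(D + U) * E * (D + U\<^sup>T) = (D + U\<^sup>T) + U * E * (D + U\<^sup>T)"
    using UE by (simp add: add_mult_distrib_mat[of _ N N _ _ N] left_mult_one_mat[of _ N N])
  also have "U * E * (D + U\<^sup>T) = U * E * D + sgs_op n s Q"
    unfolding sgs_op_def using UE by (subst mult_add_distrib_mat[of _ N N _ N]) auto
  also have "U * E * D = U"
    by (simp add: assoc_mult_mat[of _ N N _ N _ N] inv_mat_mult[OF D_carrier D_pos]
        right_mult_one_mat[of _ N N])
  also have "(D + U\<^sup>T) + (U + sgs_op n s Q) = sgs_mat n s Q + sgs_op n s Q"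
    unfolding sgs_mat_decomp
    using carrier_matD[OF U_carrier] carrier_matD[OF D_carrier] carrier_matD[OF sgs_op_carrier]
    by (intro eq_matI) auto
  finally show ?thesis by simp
qed

text \<open>The outer factors are transposes of each other, so moving the left one across the inner
  product puts \<open>y\<close> on both sides. This is the quadratic part of the completed
  square.\<close>

lemma sgs_hat_quad:
  assumes x: "x \<in> carrier_vec N"
  defines "y \<equiv> (D + U\<^sup>T) *\<^sub>v x"
  shows "x \<bullet> (sgs_mat n s Q *\<^sub>v x) + x \<bullet> (sgs_op n s Q *\<^sub>v x) = y \<bullet> (E *\<^sub>v y)"
proof -
  have y: "y \<in> carrier_vec N" using x unfolding y_def by (intro mult_mat_vec_carrier) auto
  have M: "D + U \<in> carrier_mat N N" and Mt: "(D + U)\<^sup>T = D + U\<^sup>T"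
    using pos_def_transpose[OF D_pos] by (auto simp: transpose_add[OF D_carrier U_carrier])
  have "x \<bullet> (sgs_mat n s Q *\<^sub>v x) + x \<bullet> (sgs_op n s Q *\<^sub>v x) = x \<bullet> ((D + U) *\<^sub>v (E *\<^sub>v y))"
  proof -
    have "x \<bullet> (sgs_mat n s Q *\<^sub>v x) + x \<bullet> (sgs_op n s Q *\<^sub>v x) =
        x \<bullet> ((sgs_mat n s Q + sgs_op n s Q) *\<^sub>v x)"
      using x by (simp add: add_mult_distrib_mat_vec[of _ N N] scalar_prod_add_distrib[of _ N])
    also have "(sgs_mat n s Q + sgs_op n s Q) *\<^sub>v x = (D + U) *\<^sub>v (E *\<^sub>v y)"
      unfolding sgs_hat_factor y_def using x M
      by (simp add: assoc_mult_mat_vec[of _ N N _ N] mult_carrier_mat[of _ N N])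
    finally show ?thesis .
  qed
  also have "\<dots> = (E *\<^sub>v y) \<bullet> y"
    using bilinear_transpose[OF M x, of "E *\<^sub>v y"] y by (simp add: Mt y_def)
  finally show ?thesis using y by (simp add: comm_scalar_prod[of _ N])
qed

text \<open>The sGS term is the form of \<open>E\<close> at \<open>U\<^sup>T x\<close>. If that
  vector is nonzero, this term is positive and \<open>Q\<close> contributes a nonnegative amount; if
  it vanishes, the form of \<open>Q\<close> reduces to that of \<open>D\<close>.\<close>

lemma sgs_hat_pos:
  assumes psd: "pos_semidef (sgs_mat n s Q)"
  shows "pos_def (sgs_mat n s Q + sgs_op n s Q)"
  unfolding pos_def_def
proof (intro conjI ballI impI)
  note dims = carrier_matD[OF sgs_mat_carrier] carrier_matD[OF sgs_op_carrier]
  show "square_mat (sgs_mat n s Q + sgs_op n s Q)" using dims by simp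
  show "(sgs_mat n s Q + sgs_op n s Q)\<^sup>T = sgs_mat n s Q + sgs_op n s Q"
    by (simp add: transpose_add[of _ N N] sgs_mat_transpose sgs_op_transpose)
  fix x :: "real vec"
  assume "x \<in> carrier_vec (dim_row (sgs_mat n s Q + sgs_op n s Q))"
    and "x \<noteq> 0\<^sub>v (dim_row (sgs_mat n s Q + sgs_op n s Q))"
  then have x: "x \<in> carrier_vec N" "x \<noteq> 0\<^sub>v N" using dims by auto
  have q: "0 \<le> x \<bullet> (sgs_mat n s Q *\<^sub>v x)" using psd x dims by (simp add: pos_semidef_def)
  have split: "x \<bullet> ((sgs_mat n s Q + sgs_op n s Q) *\<^sub>v x) =
      x \<bullet> (sgs_mat n s Q *\<^sub>v x) + (U\<^sup>T *\<^sub>v x) \<bullet> (E *\<^sub>v (U\<^sup>T *\<^sub>v x))"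
    using x sgs_op_quad[OF x(1)]
    by (simp add: add_mult_distrib_mat_vec[of _ N N] scalar_prod_add_distrib[of _ N])
  show "0 < x \<bullet> ((sgs_mat n s Q + sgs_op n s Q) *\<^sub>v x)"
  proof (cases "U\<^sup>T *\<^sub>v x = 0\<^sub>v N")
    case True
    have "sgs_mat n s Q *\<^sub>v x = U *\<^sub>v x + D *\<^sub>v x"
      unfolding sgs_mat_decomp using x True by (simp add: add_mult_distrib_mat_vec[of _ N N])
    moreover have "x \<bullet> (U *\<^sub>v x) = 0"
      using bilinear_transpose[OF U_carrier x(1) x(1)] True x by simp
    ultimately have "x \<bullet> (sgs_mat n s Q *\<^sub>v x) = x \<bullet> (D *\<^sub>v x)"
      using x by (simp add: scalar_prod_add_distrib[of _ N])
    then show ?thesis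
      unfolding split using pos_def_pos[OF D_pos D_carrier x] E_quad_nonneg[of "U\<^sup>T *\<^sub>v x"] x by simp
  next
    case False
    then show ?thesis unfolding split using q E_quad_pos[of "U\<^sup>T *\<^sub>v x"] x by simp
  qed
qed

section \<open>Block solves\<close>

text \<open>The dimension is read off the rows of the inverse alone. A block therefore gets its
  carrier directly from its defining equation, even though the equation for \<open>x'\<close>
  mentions \<open>x'\<close> itself.\<close>

lemma sgs_solve_carrier:
  assumes "1 \<le> i" "i \<le> s"
  shows "sgs_solve n s Q i c y z \<in> carrier_vec (n i)"
proof -
  have "inv_mat (Q i i) \<in> carrier_mat (n i) (n i)"
    using assms by (intro inv_mat_carrier Q_carrier Q_pos) auto
  then have "dim_row (inv_mat (Q i i)) = n i" by simp
  then show ?thesis by (intro carrier_vecI) (simp add: sgs_solve_def)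
qed

text \<open>Triangularity: the solve for block \<open>i\<close> reads \<open>y\<close> only before
  \<open>i\<close>. Extending a sweep, its uniqueness and the independence of block 1 from
  \<open>y\<close> all rest on this.\<close>

lemma sgs_solve_cong:
  assumes i: "1 \<le> i" "i \<le> s" and y: "\<And>j. 1 \<le> j \<Longrightarrow> j < i \<Longrightarrow> y j \<in> carrier_vec (n j)"
    and eq: "\<And>j. 1 \<le> j \<Longrightarrow> j < i \<Longrightarrow> y j = y' j"
  shows "sgs_solve n s Q i c y z = sgs_solve n s Q i c y' z"
proof -
  have "finsum_vec TYPE(real) (n i) (\<lambda>j. (Q j i)\<^sup>T *\<^sub>v y j) {1..i - 1} =
      finsum_vec TYPE(real) (n i) (\<lambda>j. (Q j i)\<^sup>T *\<^sub>v y' j) {1..i - 1}"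
  proof (rule finsum_vec_cong)
    show "(\<lambda>j. (Q j i)\<^sup>T *\<^sub>v y j) \<in> {1..i - 1} \<rightarrow> carrier_vec (n i)"
    proof (rule Pi_I)
      fix j assume "j \<in> {1..i - 1}"
      with i have "1 \<le> j" "j < i" "j \<le> i" by auto
      then show "(Q j i)\<^sup>T *\<^sub>v y j \<in> carrier_vec (n i)"
        using Q_carrier[of j i] i y[of j] by (intro mult_mat_vec_carrier[of _ _ "n j"]) auto
    qed
  qed (use i eq in auto)
  then show ?thesis by (simp add: sgs_solve_def)
qed

text \<open>Turns a block solve into a row of a linear system without inverses: \<open>x\<close>
  supplies the blocks before \<open>i\<close>, \<open>w\<close> those after
  \<open>i\<close>.\<close>

lemma Q_mult_sgs_solve:
  assumes i: "1 \<le> i" "i \<le> s" and c: "c \<in> carrier_vec (n i)"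
    and x: "x \<in> carrier_vec N" and w: "w \<in> carrier_vec N"
    and y: "\<And>j. 1 \<le> j \<Longrightarrow> j < i \<Longrightarrow> y j = block n x j"
    and z: "\<And>j. i < j \<Longrightarrow> j \<le> s \<Longrightarrow> z j = block n w j"
  shows "Q i i *\<^sub>v sgs_solve n s Q i c y z = c - block n (U\<^sup>T *\<^sub>v x) i - block n (U *\<^sub>v w) i"
proof -
  have *: "finsum_vec TYPE(real) (n i) (\<lambda>j. (Q j i)\<^sup>T *\<^sub>v y j) {1..i - 1} = block n (U\<^sup>T *\<^sub>v x) i"
    unfolding block_Ut[OF i x]
    by (rule sym, rule finsum_vec_cong)
      (use i y Q_carrier in \<open>auto intro!: mult_block_carrier\<close>)
  have **: "finsum_vec TYPE(real) (n i) (\<lambda>j. Q i j *\<^sub>v z j) {i + 1..s} = block n (U *\<^sub>v w) i"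
    unfolding block_U[OF i w]
    by (rule sym, rule finsum_vec_cong)
      (use i z Q_carrier in \<open>auto intro!: mult_block_carrier\<close>)
  show ?thesis
    unfolding sgs_solve_def * ** using i c
    by (intro mult_inv_mat_vec[where d = "n i"]) (auto intro!: minus_carrier_vec Q_pos Q_carrier)
qed

text \<open>\<open>F\<close> occurs in its own equations, so it is built by prolonging a prefix of
  length \<open>m\<close>; the equations already satisfied read only earlier blocks.\<close>

lemma sgs_forward_exists:
  assumes u: "u \<in> carrier_vec (n 1)"
  shows "\<exists>F. F 1 = u \<and> (\<forall>i\<in>{2..s}. F i = sgs_solve n s Q i (c i) F z) \<and>
    (\<forall>i\<in>{1..s}. F i \<in> carrier_vec (n i))"
proof -
  have "\<exists>F. F 1 = u \<and> (\<forall>i\<in>{2..m}. F i = sgs_solve n s Q i (c i) F z) \<and>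
    (\<forall>i\<in>{1..m}. F i \<in> carrier_vec (n i))" if "m \<le> s" for m
    using that
  proof (induction m)
    case 0
    show ?case by (intro exI[of _ "\<lambda>_. u"]) simp
  next
    case (Suc m)
    then obtain F where F: "F 1 = u" "\<And>i. i \<in> {2..m} \<Longrightarrow> F i = sgs_solve n s Q i (c i) F z"
      "\<And>i. i \<in> {1..m} \<Longrightarrow> F i \<in> carrier_vec (n i)" by auto
    show ?case
    proof (cases "m = 0")
      case True
      \<comment> \<open>The first block is prescribed as \<open>u\<close> and is not the result of a
        solve.\<close>
      then show ?thesis using F u by (intro exI[of _ F]) auto
    next
      case False
      define G where "G = F(Suc m := sgs_solve n s Q (Suc m) (c (Suc m)) F z)"
      \<comment> \<open>No solve up to index \<open>Suc m\<close> reads block \<open>Suc m\<close>,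
        so the update is invisible to all of them.\<close>
      have eq: "sgs_solve n s Q i (c i) G z = sgs_solve n s Q i (c i) F z" if "i \<in> {2..Suc m}" for i
        by (rule sgs_solve_cong[symmetric]) (use that F Suc.prems in \<open>auto simp: G_def\<close>)
      have "G i = sgs_solve n s Q i (c i) G z" if "i \<in> {2..Suc m}" for i
        unfolding eq[OF that] using that F(2)[of i] by (auto simp: G_def)
      moreover have "G i \<in> carrier_vec (n i)" if "i \<in> {1..Suc m}" for i
        using that F(3)[of i] sgs_solve_carrier[of "Suc m"] Suc.prems by (auto simp: G_def)
      moreover have "G 1 = u" using F(1) False by (simp add: G_def)
      ultimately show ?thesis by blast
    qed
  qed
  then show ?thesis by blast
qed

end

section \<open>Reduction of the minimisation problems\<close>

lemma argmin_set_singletonI: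
  assumes "x \<in> X" "\<And>y. y \<in> X \<Longrightarrow> y \<noteq> x \<Longrightarrow> f x < f y"
  shows "argmin_set f X = {x}"
proof -
  have "is_arg_min f (\<lambda>x. x \<in> X) y \<longleftrightarrow> y = x" for y
    using assms by (metis is_arg_min_def less_asym less_irrefl)
  then show ?thesis by (auto simp: argmin_set_def)
qed

text \<open>Finiteness of \<open>c\<close> is what keeps the inequality strict after adding
  \<open>c\<close> in the extended reals; for infinite \<open>c\<close> the objective would be
  constant.\<close>

lemma argmin_set_quad:
  assumes A: "A \<in> carrier_mat d d" "pos_def A" and a: "a \<in> carrier_vec d"
    and c: "\<bar>c\<bar> \<noteq> \<infinity>"
    and g: "\<And>u. u \<in> carrier_vec d \<Longrightarrow> g u = 1 / 2 * ((u - a) \<bullet> (A *\<^sub>v (u - a))) + K"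
  shows "argmin_set (\<lambda>u. c + ereal (g u)) (carrier_vec d) = {a}"
proof (rule argmin_set_singletonI[OF a])
  fix u assume u: "u \<in> carrier_vec d" "u \<noteq> a"
  have "u - a \<noteq> 0\<^sub>v d"
  proof
    assume e: "u - a = 0\<^sub>v d"
    have "u = (u - a) + a" using u a by (intro eq_vecI) auto
    then show False using e u a by simp
  qed
  then have "0 < (u - a) \<bullet> (A *\<^sub>v (u - a))" using pos_def_pos[OF A(2,1)] u a by simp
  moreover have "a - a = 0\<^sub>v d" using a by simp
  moreover have "0\<^sub>v d \<bullet> (A *\<^sub>v 0\<^sub>v d) = 0"
    using mult_mat_vec_carrier[OF A(1) zero_carrier_vec] by simp
  ultimately have "g a < g u" using g[OF a] g[OF u(1)] by simp
  then show "c + ereal (g a) < c + ereal (g u)" using c by (cases c) auto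
qed

lemma mult_mat_zero_vec:
  "(A :: real mat) \<in> carrier_mat d e \<Longrightarrow> A *\<^sub>v 0\<^sub>v e = 0\<^sub>v d"
  by (intro eq_vecI) (auto simp: scalar_prod_def)

lemma finsum_vec_zero:
  assumes "finite S" "\<And>j. j \<in> S \<Longrightarrow> f j = 0\<^sub>v d"
  shows "finsum_vec TYPE(real) d f S = 0\<^sub>v d"
proof -
  have "finsum_vec TYPE(real) d f S = finsum_vec TYPE(real) d f {}"
    using assms by (intro finsum_vec_mono_neutral_cong) auto
  then show ?thesis by (simp add: finsum_vec_empty)
qed

context sgs_blocks
begin

text \<open>Row \<open>i\<close> of a strictly upper triangular block matrix reads only blocks after
  \<open>i\<close>, and these have index at least 2.\<close>

lemma U_cong:
  assumes x: "x \<in> carrier_vec N" and y: "y \<in> carrier_vec N"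
    and eq: "\<And>i. 2 \<le> i \<Longrightarrow> i \<le> s \<Longrightarrow> block n x i = block n y i"
  shows "U *\<^sub>v x = U *\<^sub>v y"
proof (rule block_eqI)
  fix i assume i: "1 \<le> i" "i \<le> s"
  show "block n (U *\<^sub>v x) i = block n (U *\<^sub>v y) i"
    unfolding block_U[OF i x] block_U[OF i y]
    by (rule finsum_vec_cong) (use i Q_carrier eq in \<open>auto intro!: mult_block_carrier\<close>)
qed (use x y in simp_all)

text \<open>\<open>E\<close> respects blocks, so \<open>U E\<close> ignores block 1 as
  \<open>U\<close> does. This fits the equations for \<open>x'\<close>, which are given for blocks 2
  to \<open>s\<close>.\<close>

lemma UE_cong:
  assumes x: "x \<in> carrier_vec N" and y: "y \<in> carrier_vec N"
    and eq: "\<And>i. 2 \<le> i \<Longrightarrow> i \<le> s \<Longrightarrow> block n x i = block n y i"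
  shows "U *\<^sub>v (E *\<^sub>v x) = U *\<^sub>v (E *\<^sub>v y)"
proof (rule U_cong)
  fix i assume i: "2 \<le> i" "i \<le> s"
  have QE: "Q i i *\<^sub>v block n (E *\<^sub>v x) i = Q i i *\<^sub>v block n (E *\<^sub>v y) i"
    using block_D[of i "E *\<^sub>v x"] block_D[of i "E *\<^sub>v y"] i x y eq[OF i] by simp
  have i': "1 \<le> i" using i by simp
  show "block n (E *\<^sub>v x) i = block n (E *\<^sub>v y) i"
    by (rule pos_def_mult_cancel[OF Q_pos[OF i' i(2)] Q_carrier[OF i' order_refl i(2)] _ _ QE]) simp_all
qed (use x y in simp_all)

lemma block_sgs_mat:
  assumes "1 \<le> i" "i \<le> s" "x \<in> carrier_vec N"
  shows "block n (sgs_mat n s Q *\<^sub>v x) i =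
    block n (U *\<^sub>v x) i + Q i i *\<^sub>v block n x i + block n (U\<^sup>T *\<^sub>v x) i"
proof -
  have "sgs_mat n s Q *\<^sub>v x = U *\<^sub>v x + D *\<^sub>v x + U\<^sup>T *\<^sub>v x"
    unfolding sgs_mat_decomp using assms by (simp add: add_mult_distrib_mat_vec[of _ N N])
  then show ?thesis using assms by (simp add: block_add[of i s] block_D)
qed

text \<open>A quadratic in one block equals its second-order expansion at a stationary point: the
  curvature is \<open>Q i i\<close>, the gradient at \<open>a\<close> vanishes by the equation
  solved by \<open>a\<close>, and \<open>K\<close> is the value at \<open>a\<close>.\<close>

lemma sgs_quad_splice:
  assumes b: "b \<in> carrier_vec N" and i: "1 \<le> i" "i \<le> s" and d: "d \<in> carrier_vec (n i)"
    and y: "\<And>j. 1 \<le> j \<Longrightarrow> j < i \<Longrightarrow> y j \<in> carrier_vec (n j)"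
    and z: "\<And>j. i < j \<Longrightarrow> j \<le> s \<Longrightarrow> z j \<in> carrier_vec (n j)"
  defines "a \<equiv> sgs_solve n s Q i (block n b i + d) y z"
  shows "\<exists>K. \<forall>u\<in>carrier_vec (n i).
    sgs_quad n s Q b (block_vec n s (block_splice i y u z)) - d \<bullet> u =
    1 / 2 * ((u - a) \<bullet> (Q i i *\<^sub>v (u - a))) + K"
proof -
  define w where "w u = block_vec n s (block_splice i y u z)" for u
  have w[simp]: "w u \<in> carrier_vec N" for u by (simp add: w_def)
  have a: "a \<in> carrier_vec (n i)" unfolding a_def by (rule sgs_solve_carrier[OF i])
  have splice: "block_splice i y u z j \<in> carrier_vec (n j)"
    if "u \<in> carrier_vec (n i)" "1 \<le> j" "j \<le> s" for u j
    using that y[of j] z[of j] by (auto simp: block_splice_def)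
  have bw: "block n (w u) j = block_splice i y u z j"
    if "u \<in> carrier_vec (n i)" "1 \<le> j" "j \<le> s" for u j
    unfolding w_def using that splice[OF that] by (intro block_block_vec) auto
  have Qa: "Q i i *\<^sub>v a = (block n b i + d) - block n (U\<^sup>T *\<^sub>v w a) i - block n (U *\<^sub>v w a) i"
    unfolding a_def
    by (rule Q_mult_sgs_solve) (use i d bw a in \<open>auto simp: block_splice_def simp flip: a_def\<close>)
  have Qi: "Q i i \<in> carrier_mat (n i) (n i)" using Q_carrier i by simp
  \<comment> \<open>Stationarity of \<open>a\<close>: the gradient of the quadratic in block
    \<open>i\<close> equals \<open>d\<close>.\<close>
  have res: "block n (sgs_mat n s Q *\<^sub>v w a) i = block n b i + d"
    using block_sgs_mat[OF i w[of a]] bw[OF a i] Qa d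
    by (auto simp: block_splice_def intro!: eq_vecI)
  have "sgs_quad n s Q b (w u) - d \<bullet> u =
      1 / 2 * ((u - a) \<bullet> (Q i i *\<^sub>v (u - a))) + (sgs_quad n s Q b (w a) - d \<bullet> a)"
    if u: "u \<in> carrier_vec (n i)" for u
  proof -
    define v where "v = u - a"
    \<comment> \<open>The change of block \<open>i\<close>, padded with zeros. In row
      \<open>i\<close> it meets only \<open>Q i i\<close>.\<close>
    define P where "P = block_vec n s (\<lambda>j. if j = i then v else 0\<^sub>v (n j))"
    have v: "v \<in> carrier_vec (n i)" using u a by (simp add: v_def)
    have P[simp]: "P \<in> carrier_vec N" by (simp add: P_def)
    have bP: "block n P j = (if j = i then v else 0\<^sub>v (n j))" if "1 \<le> j" "j \<le> s" for j
      unfolding P_def by (rule block_block_vec) (use that v in auto)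
    have Pdot: "P \<bullet> x = v \<bullet> block n x i" if "x \<in> carrier_vec N" for x
    proof -
      have "P \<bullet> x = (\<Sum>j = 1..s. if j = i then v \<bullet> block n x i else 0)"
        unfolding scalar_prod_blocks[OF P that] by (rule sum.cong) (auto simp: bP)
      then show ?thesis using i by simp
    qed
    have wu: "w u = w a + 1 \<cdot>\<^sub>v P"
    proof (rule block_eqI[of _ n s])
      fix j assume j: "1 \<le> j" "j \<le> s"
      show "block n (w u) j = block n (w a + 1 \<cdot>\<^sub>v P) j"
        using j splice[OF a j] a u
        by (auto simp: block_add[OF j] bw bP block_splice_def v_def intro!: eq_vecI)
    qed simp_all
    have "block n (U *\<^sub>v P) i = 0\<^sub>v (n i)"
      unfolding block_U[OF i P] by (rule finsum_vec_zero) (use i bP Q_carrier in \<open>auto intro!: mult_mat_zero_vec\<close>)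
    moreover have "block n (U\<^sup>T *\<^sub>v P) i = 0\<^sub>v (n i)"
      unfolding block_Ut[OF i P] by (rule finsum_vec_zero) (use i bP Q_carrier in \<open>auto intro!: mult_mat_zero_vec\<close>)
    ultimately have "block n (sgs_mat n s Q *\<^sub>v P) i = Q i i *\<^sub>v v"
      using mult_mat_vec_carrier[OF Qi v] by (simp add: block_sgs_mat[OF i P] bP[OF i])
    then have PQP: "P \<bullet> (sgs_mat n s Q *\<^sub>v P) = v \<bullet> (Q i i *\<^sub>v v)" by (simp add: Pdot)
    have PQw: "P \<bullet> (sgs_mat n s Q *\<^sub>v w a) = v \<bullet> block n b i + v \<bullet> d"
      using v d by (simp add: Pdot res scalar_prod_add_distrib[of _ "n i"])
    have Pb: "b \<bullet> P = v \<bullet> block n b i" using b by (simp add: Pdot comm_scalar_prod[of b N])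
    have bwu: "b \<bullet> w u = b \<bullet> w a + b \<bullet> P"
      unfolding wu using b by (simp add: scalar_prod_add_distrib[of _ N])
    have "d \<bullet> u = d \<bullet> a + v \<bullet> d"
      using d u a by (simp add: v_def minus_scalar_prod_distrib[of _ "n i"] comm_scalar_prod[of d "n i"])
    then show ?thesis
      using quad_form_add[OF sgs_mat_carrier sgs_mat_transpose w P, of a 1]
      unfolding sgs_quad_def bwu Pb unfolding wu[symmetric] PQP PQw
      by (simp add: v_def[symmetric] algebra_simps)
  qed
  then show ?thesis unfolding w_def by blast
qed

section \<open>Completing the square in the full objective\<close>

lemma sgs_objective:
  assumes b: "b \<in> carrier_vec N" and xb: "xbar \<in> carrier_vec N"
    and d': "\<delta>' \<in> carrier_vec N" and d: "\<delta> \<in> carrier_vec N"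
    and x': "\<And>i. 2 \<le> i \<Longrightarrow> i \<le> s \<Longrightarrow>
      x' i = sgs_solve n s Q i (block n b i + block n \<delta>' i) (block n xbar) x'"
  defines "r \<equiv> (\<lambda>x i. block n x i -
      sgs_solve n s Q i (block n b i + block n \<delta> i) (block n x) x')"
  shows "\<exists>K. \<forall>x\<in>carrier_vec N.
    sgs_quad n s Q b x + 1 / 2 * sq_norm_wrt (sgs_op n s Q) (x - xbar) - x \<bullet> sgs_Delta n s Q \<delta>' \<delta> =
    1 / 2 * (\<Sum>i = 1..s. r x i \<bullet> (Q i i *\<^sub>v r x i)) + K"
proof -
  \<comment> \<open>\<open>x'\<close> is specified from block 2 on; the zero put into block 1 is a
    filler that \<open>U\<close> annihilates.\<close>
  define X where "X = block_vec n s (\<lambda>i. if i = 1 then 0\<^sub>v (n 1) else x' i)"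
  have X[simp]: "X \<in> carrier_vec N" by (simp add: X_def)
  have x'c: "x' i \<in> carrier_vec (n i)" if "2 \<le> i" "i \<le> s" for i
    using that sgs_solve_carrier[of i] by (subst x'[OF that]) simp
  have bX: "block n X i = x' i" if i: "2 \<le> i" "i \<le> s" for i
  proof -
    have "block n X i = (if i = 1 then 0\<^sub>v (n 1) else x' i)"
      unfolding X_def using i x'c[OF i] by (intro block_block_vec) auto
    then show ?thesis using i by simp
  qed
  define c where "c = b + \<delta> - U *\<^sub>v X"
  have c[simp]: "c \<in> carrier_vec N" using b d by (simp add: c_def)
  \<comment> \<open>The coefficient of the linear part: \<open>b\<close> from \<open>q\<close>, the
    cross term of the proximal norm, and \<open>sgs_Delta\<close>.\<close>
  define w where "w = b + sgs_op n s Q *\<^sub>v xbar + sgs_Delta n s Q \<delta>' \<delta>"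
  have Del: "sgs_Delta n s Q \<delta>' \<delta> = \<delta> + U *\<^sub>v (E *\<^sub>v (\<delta> - \<delta>'))"
    unfolding sgs_Delta_def using d d' by (simp add: assoc_mult_mat_vec[of _ N N _ N])
  have w_eq: "w = (D + U) *\<^sub>v (E *\<^sub>v c)"
  proof -
    have "U *\<^sub>v (E *\<^sub>v (U\<^sup>T *\<^sub>v xbar + (\<delta> - \<delta>'))) = U *\<^sub>v (E *\<^sub>v (c - D *\<^sub>v X))"
    proof (rule UE_cong)
      fix i assume i: "2 \<le> i" "i \<le> s"
      then have i1: "1 \<le> i" by simp
      \<comment> \<open>The defining equation of \<open>x'\<close> says that
        \<open>U\<^sup>T xbar + (\<delta> - \<delta>')\<close> and \<open>c - D X\<close> agree in
        block \<open>i\<close>.\<close>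
      have "Q i i *\<^sub>v x' i = (block n b i + block n \<delta>' i) - block n (U\<^sup>T *\<^sub>v xbar) i - block n (U *\<^sub>v X) i"
        by (subst x'[OF i], rule Q_mult_sgs_solve) (use i b d' xb bX in auto)
      then show "block n (U\<^sup>T *\<^sub>v xbar + (\<delta> - \<delta>')) i = block n (c - D *\<^sub>v X) i"
        using b d d' xb bX[OF i]
        by (auto simp: c_def block_add[OF i1 i(2)] block_minus[OF i1 i(2)] block_D[OF i1 i(2)]
            simp del: index_block intro!: eq_vecI)
    qed (use xb d d' in simp_all)
    also have "E *\<^sub>v (c - D *\<^sub>v X) = E *\<^sub>v c - X"
      by (simp add: mult_minus_distrib_mat_vec[of _ N N])
    also have "U *\<^sub>v (E *\<^sub>v c - X) = U *\<^sub>v (E *\<^sub>v c) - U *\<^sub>v X"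
      by (simp add: mult_minus_distrib_mat_vec[of _ N N])
    finally have *: "U *\<^sub>v (E *\<^sub>v (U\<^sup>T *\<^sub>v xbar)) + U *\<^sub>v (E *\<^sub>v (\<delta> - \<delta>')) =
        U *\<^sub>v (E *\<^sub>v c) - U *\<^sub>v X"
      using xb d d' by (simp add: mult_add_distrib_mat_vec[of _ N N])
    have "w = (b + \<delta>) + (U *\<^sub>v (E *\<^sub>v (U\<^sup>T *\<^sub>v xbar)) + U *\<^sub>v (E *\<^sub>v (\<delta> - \<delta>')))"
    proof -
      have "sgs_op n s Q *\<^sub>v xbar \<in> carrier_vec N" "U *\<^sub>v (E *\<^sub>v (\<delta> - \<delta>')) \<in> carrier_vec N"
        using xb d d' by simp_all
      then show ?thesis
        unfolding w_def Del sgs_op_vec[OF xb, symmetric] using b d by (intro eq_vecI) auto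
    qed
    also have "\<dots> = c + U *\<^sub>v (E *\<^sub>v c)"
    proof -
      have "U *\<^sub>v (E *\<^sub>v c) \<in> carrier_vec N" "U *\<^sub>v X \<in> carrier_vec N" by simp_all
      then show ?thesis unfolding * unfolding c_def using b d carrier_matD[OF U_carrier]
        by (intro eq_vecI) auto
    qed
    also have "\<dots> = (D + U) *\<^sub>v (E *\<^sub>v c)"
      by (simp add: add_mult_distrib_mat_vec[of _ N N])
    finally show ?thesis .
  qed
  have w[simp]: "w \<in> carrier_vec N" unfolding w_eq by (intro mult_mat_vec_carrier[of _ N N]) auto
  have Delc: "sgs_Delta n s Q \<delta>' \<delta> \<in> carrier_vec N" using d d' by (simp add: Del)
  \<comment> \<open>The constant is the part of the proximal norm in \<open>xbar\<close> alone,
    minus the term in \<open>c\<close> added to complete the square.\<close>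
  have "sgs_quad n s Q b x + 1 / 2 * sq_norm_wrt (sgs_op n s Q) (x - xbar) - x \<bullet> sgs_Delta n s Q \<delta>' \<delta> =
    1 / 2 * (\<Sum>i = 1..s. r x i \<bullet> (Q i i *\<^sub>v r x i)) +
    1 / 2 * (xbar \<bullet> (sgs_op n s Q *\<^sub>v xbar) - (E *\<^sub>v c) \<bullet> c)"
    if x: "x \<in> carrier_vec N" for x
  proof -
    define y where "y = (D + U\<^sup>T) *\<^sub>v x"
    define e where "e = E *\<^sub>v (y - c)"
    have y[simp]: "y \<in> carrier_vec N" unfolding y_def using x by (intro mult_mat_vec_carrier) auto
    have e: "e \<in> carrier_vec N" by (simp add: e_def)
    have De: "D *\<^sub>v e = y - c" by (simp add: e_def)
    \<comment> \<open>Multiplied by \<open>Q i i\<close>, both sides become block \<open>i\<close>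
      of \<open>D x + U\<^sup>T x - c\<close>.\<close>
    have rx: "block n e i = r x i" if i: "1 \<le> i" "i \<le> s" for i
    proof -
      have Qi: "Q i i \<in> carrier_mat (n i) (n i)" using Q_carrier i by simp
      let ?a = "sgs_solve n s Q i (block n b i + block n \<delta> i) (block n x) x'"
      have a: "?a \<in> carrier_vec (n i)" by (rule sgs_solve_carrier[OF i])
      have Qa: "Q i i *\<^sub>v ?a = (block n b i + block n \<delta> i) - block n (U\<^sup>T *\<^sub>v x) i - block n (U *\<^sub>v X) i"
        by (rule Q_mult_sgs_solve) (use i x bX in auto)
      have Qx: "Q i i *\<^sub>v block n x i \<in> carrier_vec (n i)" using Qi by (rule mult_block_carrier)
      have "y = D *\<^sub>v x + U\<^sup>T *\<^sub>v x"
        unfolding y_def using x by (simp add: add_mult_distrib_mat_vec[of _ N N])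
      then have "Q i i *\<^sub>v block n e i = Q i i *\<^sub>v block n x i - Q i i *\<^sub>v ?a"
        unfolding block_D[OF i e, symmetric] De Qa c_def using x b d Qx
        by (auto simp: block_add[OF i] block_minus[OF i] block_D[OF i] simp del: index_block
            intro!: eq_vecI)
      also have "\<dots> = Q i i *\<^sub>v r x i"
        unfolding r_def by (rule mult_minus_distrib_mat_vec[OF Qi _ a, symmetric]) simp
      finally have QE: "Q i i *\<^sub>v block n e i = Q i i *\<^sub>v r x i" .
      show ?thesis
        by (rule pos_def_mult_cancel[OF Q_pos[OF i] Qi _ _ QE]) (use a in \<open>simp_all add: r_def\<close>)
    qed
    have Ey: "y \<bullet> (E *\<^sub>v c) = x \<bullet> w"
    proof -
      have M: "D + U \<in> carrier_mat N N" "(D + U)\<^sup>T = D + U\<^sup>T"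
        using pos_def_transpose[OF D_pos] by (auto simp: transpose_add[OF D_carrier U_carrier])
      show ?thesis
        unfolding w_eq bilinear_transpose[OF M(1) x mult_vec_carrier[OF E_carrier c]] M(2) y_def[symmetric]
        by (simp add: comm_scalar_prod[of _ N])
    qed
    have Ecy: "c \<bullet> (E *\<^sub>v y) = x \<bullet> w"
      using bilinear_transpose[OF E_carrier c y] Ey by (simp add: E_transpose)
    have "(\<Sum>i = 1..s. r x i \<bullet> (Q i i *\<^sub>v r x i)) = e \<bullet> (D *\<^sub>v e)"
      unfolding D_quad[OF e] by (rule sum.cong) (auto simp: rx)
    also have "\<dots> = (y - c) \<bullet> (E *\<^sub>v (y - c))"
      unfolding De unfolding e_def by (simp add: comm_scalar_prod[of _ N])
    also have "\<dots> = y \<bullet> (E *\<^sub>v y) - 2 * (x \<bullet> w) + (E *\<^sub>v c) \<bullet> c"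
      using Ey Ecy by (simp add: mult_minus_distrib_mat_vec[of _ N N] scalar_prod_minus_distrib[of _ N]
          minus_scalar_prod_distrib[of _ N] comm_scalar_prod[of "E *\<^sub>v c" N])
    finally have sum: "(\<Sum>i = 1..s. r x i \<bullet> (Q i i *\<^sub>v r x i)) =
        x \<bullet> (sgs_mat n s Q *\<^sub>v x) + x \<bullet> (sgs_op n s Q *\<^sub>v x) - 2 * (x \<bullet> w) + (E *\<^sub>v c) \<bullet> c"
      using sgs_hat_quad[OF x] by (simp add: y_def)
    have Tsym: "xbar \<bullet> (sgs_op n s Q *\<^sub>v x) = x \<bullet> (sgs_op n s Q *\<^sub>v xbar)"
      using bilinear_transpose[OF sgs_op_carrier xb x] by (simp add: sgs_op_transpose)
    have sq: "sq_norm_wrt (sgs_op n s Q) (x - xbar) =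
        x \<bullet> (sgs_op n s Q *\<^sub>v x) - 2 * (x \<bullet> (sgs_op n s Q *\<^sub>v xbar)) + xbar \<bullet> (sgs_op n s Q *\<^sub>v xbar)"
      unfolding sq_norm_wrt_def using x xb Tsym
      by (simp add: mult_minus_distrib_mat_vec[of _ N N] scalar_prod_minus_distrib[of _ N]
          minus_scalar_prod_distrib[of _ N])
    have "x \<bullet> w = b \<bullet> x + x \<bullet> (sgs_op n s Q *\<^sub>v xbar) + x \<bullet> sgs_Delta n s Q \<delta>' \<delta>"
      unfolding w_def using x b xb Delc
      by (simp add: scalar_prod_add_distrib[of _ N] comm_scalar_prod[of b N])
    then show ?thesis unfolding sum sq sgs_quad_def by (simp add: algebra_simps)
  qed
  then show ?thesis by blast
qed

section \<open>Forward sweep and minimiser\<close>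

text \<open>By strong induction, each solve reads blocks on which \<open>x\<close> and
  \<open>F\<close> already agree.\<close>

lemma sgs_solve_unique:
  assumes x: "x \<in> carrier_vec N" and F: "\<And>i. i \<in> {1..s} \<Longrightarrow> F i \<in> carrier_vec (n i)"
    and one: "block n x 1 = F 1"
    and eqx: "\<And>i. 2 \<le> i \<Longrightarrow> i \<le> s \<Longrightarrow> block n x i = sgs_solve n s Q i (c i) (block n x) z"
    and eqF: "\<And>i. 2 \<le> i \<Longrightarrow> i \<le> s \<Longrightarrow> F i = sgs_solve n s Q i (c i) F z"
  shows "x = block_vec n s F"
proof (rule block_eqI[OF x block_vec_carrier])
  fix i assume "1 \<le> i" "i \<le> s"
  then have "block n x i = F i"
  proof (induction i rule: less_induct)
    case (less i)
    show ?case
    proof (cases "i = 1")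
      case True
      then show ?thesis using one by simp
    next
      case False
      then have i: "2 \<le> i" using less.prems by simp
      show ?thesis
        unfolding eqx[OF i less.prems(2)] eqF[OF i less.prems(2)]
        by (rule sgs_solve_cong) (use less F in auto)
    qed
  qed
  then show "block n x i = block n (block_vec n s F) i"
    using block_block_vec[of i s F n] F[of i] \<open>1 \<le> i\<close> \<open>i \<le> s\<close> by simp
qed

text \<open>Up to a constant the objective is \<open>p + g\<close> at block 1 plus half of
  \<open>S\<close>. The proximal point minimises the former and the sweep from it makes
  \<open>S\<close> zero, so the two are minimised together. Finiteness of \<open>p\<close> at the
  first block is recorded for the later block problems.\<close>

lemma sgs_minimizer:
  assumes s: "2 \<le> s" and b: "b \<in> carrier_vec N"
    and p: "proper_fun (n 1) p" "closed_fun (n 1) p" "convex_fun (n 1) p"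
    and xb: "xbar \<in> carrier_vec N" and d': "\<delta>' \<in> carrier_vec N" and d: "\<delta> \<in> carrier_vec N"
    and x': "\<And>i. 2 \<le> i \<Longrightarrow> i \<le> s \<Longrightarrow>
      x' i = sgs_solve n s Q i (block n b i + block n \<delta>' i) (block n xbar) x'"
  shows "\<exists>xplus\<in>carrier_vec N.
    argmin_set (\<lambda>x. p (block n x 1) +
        ereal (sgs_quad n s Q b x + 1 / 2 * sq_norm_wrt (sgs_op n s Q) (x - xbar)
          - x \<bullet> sgs_Delta n s Q \<delta>' \<delta>)) (carrier_vec N) = {xplus} \<and>
    argmin_set (\<lambda>u. p u +
        ereal (sgs_quad n s Q b (block_vec n s (block_splice 1 (block n xplus) u x'))
          - block n \<delta> 1 \<bullet> u)) (carrier_vec (n 1)) = {block n xplus 1} \<and>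
    p (block n xplus 1) \<noteq> \<infinity> \<and>
    (\<forall>i\<in>{2..s}. block n xplus i =
        sgs_solve n s Q i (block n b i + block n \<delta> i) (block n xplus) x')"
proof -
  have s1: "1 \<le> s" using s by simp
  have Q1: "Q 1 1 \<in> carrier_mat (n 1) (n 1)" "pos_def (Q 1 1)"
    using Q_carrier Q_pos s1 by auto
  have ninf: "p u \<noteq> -\<infinity>" if "u \<in> carrier_vec (n 1)" for u
    using p(1) that by (simp add: proper_fun_def)
  have x'c: "x' i \<in> carrier_vec (n i)" if "2 \<le> i" "i \<le> s" for i
    using that sgs_solve_carrier[of i] by (subst x'[OF that]) simp
  define c where "c i = block n b i + block n \<delta> i" for i
  define sol where "sol y i = sgs_solve n s Q i (c i) y x'" for y i
  \<comment> \<open>The argument \<open>x'\<close> is a placeholder, since block 1 has no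
    predecessors.\<close>
  define a where "a = sol x' 1"
  have sol1: "sol y 1 = a" for y
    unfolding a_def sol_def by (rule sgs_solve_cong) (use s1 in auto)
  have a: "a \<in> carrier_vec (n 1)" unfolding a_def sol_def by (rule sgs_solve_carrier) (use s1 in auto)
  define g where "g u = 1 / 2 * ((u - a) \<bullet> (Q 1 1 *\<^sub>v (u - a)))" for u
  obtain u where u: "u \<in> carrier_vec (n 1)" "p u \<noteq> \<infinity>"
    and min: "\<And>v. v \<in> carrier_vec (n 1) \<Longrightarrow> v \<noteq> u \<Longrightarrow> p u + ereal (g u) < p v + ereal (g v)"
    using prox_exists[OF p Q1 a] unfolding g_def by blast
  obtain pu where pu: "p u = ereal pu" using u ninf[of u] by (cases "p u") auto
  obtain F where F1: "F 1 = u" and F: "\<And>i. i \<in> {2..s} \<Longrightarrow> F i = sol F i"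
    and Fc: "\<And>i. i \<in> {1..s} \<Longrightarrow> F i \<in> carrier_vec (n i)"
    using sgs_forward_exists[OF u(1), of c x'] unfolding sol_def by blast
  define xp where "xp = block_vec n s F"
  have xp: "xp \<in> carrier_vec N" by (simp add: xp_def)
  have bxp: "block n xp i = F i" if "i \<in> {1..s}" for i
    unfolding xp_def using that Fc by (intro block_block_vec) auto
  have xp1: "block n xp 1 = u" using bxp[of 1] F1 s1 by simp
  have xpi: "block n xp i = sol (block n xp) i" if "i \<in> {2..s}" for i
  proof -
    have "sol F i = sol (block n xp) i"
      unfolding sol_def by (rule sgs_solve_cong) (use that bxp Fc in auto)
    then show ?thesis using that F bxp[of i] by simp
  qed
  define r where "r x i = block n x i - sol (block n x) i" for x i
  have rc: "r x i \<in> carrier_vec (n i)" if "i \<in> {1..s}" for x i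
    unfolding r_def sol_def using that by (intro minus_carrier_vec sgs_solve_carrier) auto
  define S where "S x = (\<Sum>i = 2..s. r x i \<bullet> (Q i i *\<^sub>v r x i))" for x
  have term_nonneg: "0 \<le> r x i \<bullet> (Q i i *\<^sub>v r x i)" if "i \<in> {2..s}" for x i
    using that by (intro pos_def_nonneg[OF Q_pos[of i] Q_carrier[of i i]] rc) auto
  have S_nonneg: "0 \<le> S x" for x unfolding S_def by (intro sum_nonneg term_nonneg)
  have S_xp: "S xp = 0"
    unfolding S_def
  proof (rule sum.neutral, rule ballI)
    fix i assume i: "i \<in> {2..s}"
    have "r xp i = 0\<^sub>v (n i)" unfolding r_def xpi[OF i, symmetric] by simp
    moreover have "Q i i *\<^sub>v 0\<^sub>v (n i) \<in> carrier_vec (n i)"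
      using Q_carrier[of i i] i by (intro mult_mat_vec_carrier[of _ _ "n i"]) auto
    ultimately show "r xp i \<bullet> (Q i i *\<^sub>v r xp i) = 0" by simp
  qed
  have S_pos: "0 < S x" if x: "x \<in> carrier_vec N" "x \<noteq> xp" and one: "block n x 1 = u" for x
  proof -
    have "\<exists>i\<in>{2..s}. block n x i \<noteq> sol (block n x) i"
    proof (rule ccontr)
      assume "\<not> ?thesis"
      then have "x = block_vec n s F"
        using F F1 Fc one unfolding sol_def by (intro sgs_solve_unique[OF x(1), of F c x']) auto
      then show False using x(2) by (simp add: xp_def)
    qed
    then obtain i where i: "i \<in> {2..s}" "block n x i \<noteq> sol (block n x) i" by blast
    have "r x i \<noteq> 0\<^sub>v (n i)"
    proof
      assume z: "r x i = 0\<^sub>v (n i)"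
      have "sol (block n x) i \<in> carrier_vec (n i)"
        unfolding sol_def using i by (intro sgs_solve_carrier) auto
      then have "block n x i = r x i + sol (block n x) i"
        unfolding r_def by (intro eq_vecI) auto
      then show False using z i \<open>sol (block n x) i \<in> carrier_vec (n i)\<close> by simp
    qed
    then have "0 < r x i \<bullet> (Q i i *\<^sub>v r x i)"
      using i rc by (intro pos_def_pos[OF Q_pos[of i] Q_carrier[of i i]]) auto
    then show ?thesis
      unfolding S_def using i term_nonneg by (intro sum_pos2[of _ i]) auto
  qed
  define G where "G x = sgs_quad n s Q b x + 1 / 2 * sq_norm_wrt (sgs_op n s Q) (x - xbar)
      - x \<bullet> sgs_Delta n s Q \<delta>' \<delta>" for x
  obtain K where K: "\<And>x. x \<in> carrier_vec N \<Longrightarrow>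
      G x = 1 / 2 * (\<Sum>i = 1..s. r x i \<bullet> (Q i i *\<^sub>v r x i)) + K"
    using sgs_objective[OF b xb d' d x'] unfolding G_def r_def sol_def c_def by blast
  have G: "G x = g (block n x 1) + 1 / 2 * S x + K" if "x \<in> carrier_vec N" for x
  proof -
    have "{1..s} = insert 1 {2..s}" using s1 by auto
    then have "(\<Sum>i = 1..s. r x i \<bullet> (Q i i *\<^sub>v r x i)) = r x 1 \<bullet> (Q 1 1 *\<^sub>v r x 1) + S x"
      unfolding S_def by simp
    moreover have "r x 1 = block n x 1 - a" unfolding r_def sol1 ..
    ultimately show ?thesis using K[OF that] by (simp add: g_def algebra_simps)
  qed
  have "argmin_set (\<lambda>x. p (block n x 1) + ereal (G x)) (carrier_vec N) = {xp}"
  proof (rule argmin_set_singletonI[OF xp])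
    fix x assume x: "x \<in> carrier_vec N" "x \<noteq> xp"
    show "p (block n xp 1) + ereal (G xp) < p (block n x 1) + ereal (G x)"
    \<comment> \<open>With the same first block, strictness must come from \<open>S\<close>;
      otherwise it comes from the proximal problem and \<open>S\<close> only has to be
      nonnegative.\<close>
    proof (cases "block n x 1 = u")
      case True
      then show ?thesis
        unfolding G[OF x(1)] G[OF xp] xp1 True S_xp pu using S_pos[OF x True] by simp
    next
      case False
      from min[OF block_carrier False] S_nonneg[of x] show ?thesis
        unfolding G[OF x(1)] G[OF xp] xp1 S_xp pu by (cases "p (block n x 1)") auto
    qed
  qed
  moreover have "argmin_set (\<lambda>v. p v +
      ereal (sgs_quad n s Q b (block_vec n s (block_splice 1 (block n xp) v x')) - block n \<delta> 1 \<bullet> v))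
      (carrier_vec (n 1)) = {u}"
  proof (rule argmin_set_singletonI[OF u(1)])
    \<comment> \<open>The same centre \<open>a\<close> appears, so up to a constant this is the
      problem already solved by \<open>u\<close>.\<close>
    have "\<exists>K. \<forall>v\<in>carrier_vec (n 1).
        sgs_quad n s Q b (block_vec n s (block_splice 1 (block n xp) v x')) - block n \<delta> 1 \<bullet> v = g v + K"
      using sgs_quad_splice[OF b _ s1, of "block n \<delta> 1" "block n xp" x'] x'c
        sol1[of "block n xp"] unfolding g_def sol_def c_def by auto
    then obtain K' where K': "\<And>v. v \<in> carrier_vec (n 1) \<Longrightarrow>
        sgs_quad n s Q b (block_vec n s (block_splice 1 (block n xp) v x')) - block n \<delta> 1 \<bullet> v = g v + K'"
      by blast
    fix v assume v: "v \<in> carrier_vec (n 1)" "v \<noteq> u"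
    show "p u + ereal (sgs_quad n s Q b (block_vec n s (block_splice 1 (block n xp) u x')) - block n \<delta> 1 \<bullet> u)
      < p v + ereal (sgs_quad n s Q b (block_vec n s (block_splice 1 (block n xp) v x')) - block n \<delta> 1 \<bullet> v)"
      unfolding K'[OF u(1)] K'[OF v(1)] using min[OF v] by (cases "p v") (auto simp: pu)
  qed
  ultimately show ?thesis
    using xp xpi u(2) unfolding G_def sol_def c_def xp1[symmetric] by blast
qed

lemma sgs_block_argmin:
  assumes b: "b \<in> carrier_vec N" and i: "1 \<le> i" "i \<le> s" and d: "d \<in> carrier_vec (n i)"
    and y: "\<And>j. 1 \<le> j \<Longrightarrow> j < i \<Longrightarrow> y j \<in> carrier_vec (n j)"
    and z: "\<And>j. i < j \<Longrightarrow> j \<le> s \<Longrightarrow> z j \<in> carrier_vec (n j)"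
    and c: "\<bar>c\<bar> \<noteq> \<infinity>"
  shows "argmin_set
      (\<lambda>u. c + ereal (sgs_quad n s Q b (block_vec n s (block_splice i y u z)) - d \<bullet> u))
      (carrier_vec (n i)) = {sgs_solve n s Q i (block n b i + d) y z}"
proof -
  obtain K where "\<And>u. u \<in> carrier_vec (n i) \<Longrightarrow>
      sgs_quad n s Q b (block_vec n s (block_splice i y u z)) - d \<bullet> u =
      1 / 2 * ((u - sgs_solve n s Q i (block n b i + d) y z) \<bullet>
        (Q i i *\<^sub>v (u - sgs_solve n s Q i (block n b i + d) y z))) + K"
    using sgs_quad_splice[OF b i d y z] by blast
  then show ?thesis
    by (rule argmin_set_quad[OF Q_carrier[OF i(1) order_refl i(2)] Q_pos[OF i] sgs_solve_carrier[OF i] c])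
qed

end

theorem theorem1:
  fixes s :: nat and n :: "nat \<Rightarrow> nat" and Q :: "nat \<Rightarrow> nat \<Rightarrow> real mat"
    and b :: "real vec" and p :: "real vec \<Rightarrow> ereal"
  assumes "2 \<le> s"
    and "\<And>i j. 1 \<le> i \<Longrightarrow> i \<le> j \<Longrightarrow> j \<le> s \<Longrightarrow> Q i j \<in> carrier_mat (n i) (n j)"
    and "b \<in> carrier_vec (total_dim n s)"
    and "proper_fun (n 1) p" and "closed_fun (n 1) p" and "convex_fun (n 1) p"
    and "pos_semidef (sgs_mat n s Q)"
    and "\<And>i. 1 \<le> i \<Longrightarrow> i \<le> s \<Longrightarrow> pos_def (Q i i)"
  shows
    "sgs_mat n s Q + sgs_op n s Q =
       (sgs_diag n s Q + sgs_upper n s Q) * inv_mat (sgs_diag n s Q) *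
       (sgs_diag n s Q + (sgs_upper n s Q)\<^sup>T) \<and>
     pos_def (sgs_mat n s Q + sgs_op n s Q) \<and>
     (\<forall>xbar\<in>carrier_vec (total_dim n s).
      \<forall>\<delta>'\<in>carrier_vec (total_dim n s). \<forall>\<delta>\<in>carrier_vec (total_dim n s).
      \<forall>x' :: nat \<Rightarrow> real vec.
        block n \<delta>' 1 = block n \<delta> 1 \<longrightarrow>
        (\<forall>i\<in>{2..s}. x' i =
           sgs_solve n s Q i (block n b i + block n \<delta>' i) (block n xbar) x') \<longrightarrow>
        (\<forall>i\<in>{2..s}.
           argmin_set
             (\<lambda>u. (if p (block n xbar 1) = \<infinity> then 0 else p (block n xbar 1)) +
                ereal (sgs_quad n s Q b (block_vec n s (block_splice i (block n xbar) u x'))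
                       - block n \<delta>' i \<bullet> u))
             (carrier_vec (n i)) = {x' i}) \<and>
        (\<exists>xplus\<in>carrier_vec (total_dim n s).
           argmin_set
             (\<lambda>x. p (block n x 1) +
                ereal (sgs_quad n s Q b x + 1 / 2 * sq_norm_wrt (sgs_op n s Q) (x - xbar)
                       - x \<bullet> sgs_Delta n s Q \<delta>' \<delta>))
             (carrier_vec (total_dim n s)) = {xplus} \<and>
           argmin_set
             (\<lambda>u. p u +
                ereal (sgs_quad n s Q b (block_vec n s (block_splice 1 (block n xplus) u x'))
                       - block n \<delta> 1 \<bullet> u))
             (carrier_vec (n 1)) = {block n xplus 1} \<and>
           (\<forall>i\<in>{2..s}.
              argmin_set
                (\<lambda>u. p (block n xplus 1) +
                   ereal (sgs_quad n s Q b (block_vec n s (block_splice i (block n xplus) u x'))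
                          - block n \<delta> i \<bullet> u))
                (carrier_vec (n i)) = {block n xplus i} \<and>
              block n xplus i =
                sgs_solve n s Q i (block n b i + block n \<delta> i) (block n xplus) x')))"
proof -
  interpret sgs_blocks s n Q
    by standard (use assms(2,8) in blast)+
  show ?thesis
  proof (intro conjI ballI allI impI)
    show "sgs_mat n s Q + sgs_op n s Q = (D + U) * E * (D + U\<^sup>T)" by (rule sgs_hat_factor)
    show "pos_def (sgs_mat n s Q + sgs_op n s Q)" by (rule sgs_hat_pos[OF assms(7)])
  next
    fix xbar \<delta>' \<delta> :: "real vec" and x' :: "nat \<Rightarrow> real vec" and i
    assume xb: "xbar \<in> carrier_vec N" and i: "i \<in> {2..s}"
      and x': "\<forall>i\<in>{2..s}. x' i = sgs_solve n s Q i (block n b i + block n \<delta>' i) (block n xbar) x'"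
    let ?c = "if p (block n xbar 1) = \<infinity> then 0 else p (block n xbar 1)"
    have x'c: "x' j \<in> carrier_vec (n j)" if "2 \<le> j" "j \<le> s" for j
      by (subst x'[rule_format]) (use that in \<open>auto intro!: sgs_solve_carrier\<close>)
    have "p (block n xbar 1) \<noteq> -\<infinity>" using assms(4) by (simp add: proper_fun_def)
    \<comment> \<open>The value plus infinity was replaced by 0 and properness excludes minus
      infinity, so the added constant is finite.\<close>
    then have "\<bar>?c\<bar> \<noteq> \<infinity>" by (cases "p (block n xbar 1)") auto
    then have "argmin_set
        (\<lambda>u. ?c + ereal (sgs_quad n s Q b (block_vec n s (block_splice i (block n xbar) u x'))
          - block n \<delta>' i \<bullet> u)) (carrier_vec (n i)) =
        {sgs_solve n s Q i (block n b i + block n \<delta>' i) (block n xbar) x'}"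
      using i x'c by (intro sgs_block_argmin[OF assms(3)]) auto
    then show "argmin_set
        (\<lambda>u. ?c + ereal (sgs_quad n s Q b (block_vec n s (block_splice i (block n xbar) u x'))
          - block n \<delta>' i \<bullet> u)) (carrier_vec (n i)) = {x' i}"
      using x'[rule_format, OF i] by simp
  next
    fix xbar \<delta>' \<delta> :: "real vec" and x' :: "nat \<Rightarrow> real vec"
    assume xb: "xbar \<in> carrier_vec N" and d: "\<delta>' \<in> carrier_vec N" "\<delta> \<in> carrier_vec N"
      and x': "\<forall>i\<in>{2..s}. x' i = sgs_solve n s Q i (block n b i + block n \<delta>' i) (block n xbar) x'"
    have x'c: "x' j \<in> carrier_vec (n j)" if "2 \<le> j" "j \<le> s" for j
      by (subst x'[rule_format]) (use that in \<open>auto intro!: sgs_solve_carrier\<close>)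
    obtain xplus where xp: "xplus \<in> carrier_vec N"
      and A: "argmin_set (\<lambda>x. p (block n x 1) +
          ereal (sgs_quad n s Q b x + 1 / 2 * sq_norm_wrt (sgs_op n s Q) (x - xbar)
            - x \<bullet> sgs_Delta n s Q \<delta>' \<delta>)) (carrier_vec N) = {xplus}"
      and B: "argmin_set (\<lambda>u. p u +
          ereal (sgs_quad n s Q b (block_vec n s (block_splice 1 (block n xplus) u x'))
            - block n \<delta> 1 \<bullet> u)) (carrier_vec (n 1)) = {block n xplus 1}"
      and fin: "p (block n xplus 1) \<noteq> \<infinity>"
      and C: "\<And>i. i \<in> {2..s} \<Longrightarrow> block n xplus i =
          sgs_solve n s Q i (block n b i + block n \<delta> i) (block n xplus) x'"
      using sgs_minimizer[OF assms(1,3-6) xb d, of x'] x' by auto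
    have "p (block n xplus 1) \<noteq> -\<infinity>" using assms(4) by (simp add: proper_fun_def)
    \<comment> \<open>Here finiteness comes from optimality: the minimiser lies in the domain of
      \<open>p\<close>.\<close>
    with fin have abs: "\<bar>p (block n xplus 1)\<bar> \<noteq> \<infinity>"
      by (cases "p (block n xplus 1)") auto
    have "argmin_set
        (\<lambda>u. p (block n xplus 1) +
          ereal (sgs_quad n s Q b (block_vec n s (block_splice i (block n xplus) u x'))
            - block n \<delta> i \<bullet> u)) (carrier_vec (n i)) = {block n xplus i}" if i: "i \<in> {2..s}" for i
    proof -
      have "argmin_set
        (\<lambda>u. p (block n xplus 1) +
          ereal (sgs_quad n s Q b (block_vec n s (block_splice i (block n xplus) u x'))
            - block n \<delta> i \<bullet> u)) (carrier_vec (n i)) =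
        {sgs_solve n s Q i (block n b i + block n \<delta> i) (block n xplus) x'}"
        by (rule sgs_block_argmin[OF assms(3) _ _ _ _ _ abs]) (use i x'c in auto)
      then show ?thesis unfolding C[OF i, symmetric] .
    qed
    with xp A B C show "\<exists>xplus\<in>carrier_vec N.
        argmin_set (\<lambda>x. p (block n x 1) +
          ereal (sgs_quad n s Q b x + 1 / 2 * sq_norm_wrt (sgs_op n s Q) (x - xbar)
            - x \<bullet> sgs_Delta n s Q \<delta>' \<delta>)) (carrier_vec N) = {xplus} \<and>
        argmin_set (\<lambda>u. p u +
          ereal (sgs_quad n s Q b (block_vec n s (block_splice 1 (block n xplus) u x'))
            - block n \<delta> 1 \<bullet> u)) (carrier_vec (n 1)) = {block n xplus 1} \<and>
        (\<forall>i\<in>{2..s}. argmin_set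
            (\<lambda>u. p (block n xplus 1) +
              ereal (sgs_quad n s Q b (block_vec n s (block_splice i (block n xplus) u x'))
                - block n \<delta> i \<bullet> u)) (carrier_vec (n i)) = {block n xplus i} \<and>
          block n xplus i = sgs_solve n s Q i (block n b i + block n \<delta> i) (block n xplus) x')"
      by blast
  qed
qed

end
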